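(* Let $\widehat{\mathbf M}=(\hat{\mathbb X},\hat{\mathbb U},\mathbb Y,\hat x_0,\hat{\mathbf t},\hat h)$ be a gMDP, $\psi$ an scLTL formula with DFA $\mathcal A_\psi=(Q,q_0,\Sigma,F,\tau)$, $\epsilon,\delta\ge0$, and $\mu$ a stationary Markov policy on $\widehat{\mathbf M}\otimes\mathcal A_\psi$. Let $V^\mu_\infty=\lim_{l\to\infty}(\mathbf T^\mu_{\epsilon,\delta})^l(0)$ and $$\mathcal S^\mu_{\epsilon,\delta}:=\min_{\bar q_0\in\bar\tau(q_0,\hat x_0)}\max\{\mathbf 1_F(\bar q_0),V^\mu_\infty(\hat x_0,\bar q_0)\}.$$ Then for every gMDP $\mathbf M$ with the same metric output space such that $\widehat{\mathbf M}\preceq^\delta_\epsilon\mathbf M$, one can construct a control strategy $\mathbf C$ for $\mathbf M$ such that $\mathbb P_{\mathbf C\times\mathbf M}(\boldsymbol\omega\models\psi)\ge\mathcal S^\mu_{\epsilon,\delta}$.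
   Context: A gMDP is $\mathbf M=(\mathbb X,\mathbb U,\mathbb Y,x_0,\mathbf t,h)$: Polish state space $\mathbb X$ and input space $\mathbb U$, output space $\mathbb Y$ with metric $\mathbf d_{\mathbb Y}$, initial state $x_0$, kernel $\mathbf t(\cdot\mid x,u)$, measurable output map $h$; $x_{t+1}\sim\mathbf t(\cdot\mid x_t,u_t)$, $y_t=h(x_t)$. A control strategy for $\mathbf M$ is a gMDP with memory state space, input space $\mathbb X$, output space $\mathcal P(\mathbb U)$ (universally measurable kernel and output map), reading the state of $\mathbf M$ and outputting a distribution from which the input is drawn; $\mathbb P_{\mathbf C\times\mathbf M}$ is the induced measure on output traces. $\Sigma=2^{\mathsf{AP}}$ ($\mathsf{AP}$ finite), $\mathsf L:\mathbb Y\to\Sigma$ measurable labelling, word $\boldsymbol\omega=\mathsf L(y_0)\mathsf L(y_1)\cdots$; $\psi$ scLTL and $\mathcal A_\psi=(Q,q_0,\Sigma,F,\tau)$ a DFA accepting exactly the words satisfying $\psi$ (finite run $q_{i+1}=\tau(q_i,\omega_i)$ reaching $F$). Product $\widehat{\mathbf M}\otimes\mathcal A_\psi$: states $\hat{\mathbb X}\times Q$, inputs $\hat{\mathbb U}$; a stationary Markov policy is a universally measurable $\mu:\hat{\mathbb X}\times Q\to\mathcal P(\hat{\mathbb U})$. Let $\mathcal N_\epsilon(y)=\{y'\in\mathbb Y:\mathbf d_{\mathbb Y}(y',y)\le\epsilon\}$ and $\bar\tau(q,\hat x')=\{\tau(q,\alpha):\alpha\in\mathsf L(\mathcal N_\epsilon(\hat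 h(\hat x')))\}$. The $(\epsilon,\delta)$-robust operator on $V:\hat{\mathbb X}\times Q\to[0,1]$ is $\mathbf T^\mu_{\epsilon,\delta}(V)(\hat x,q)=\mathbf L\big(\int_{\hat{\mathbb X}}\min_{q'\in\bar\tau(q,\hat x')}\max\{\mathbf 1_F(q'),V(\hat x',q')\}\,\hat{\mathbf t}(d\hat x'\mid\hat x,\mu(\hat x,q))-\delta\big)$, with $\mathbf L(r)=\min(1,\max(0,r))$. $\widehat{\mathbf M}\preceq^\delta_\epsilon\mathbf M$ means there exist an interface $\mathcal U_v:\hat{\mathbb U}\times\hat{\mathbb X}\times\mathbb X\to\mathcal P(\mathbb U)$, a measurable relation $\mathcal R\subseteq\hat{\mathbb X}\times\mathbb X$ and a Borel kernel $\mathbb W_{\mathbf t}(\cdot\mid\hat u,\hat x,x)$ on $\hat{\mathbb X}\times\mathbb X$ with $(\hat x_0,x_0)\in\mathcal R$ and, for all $(\hat x,x)\in\mathcal R$: $\mathbf d_{\mathbb Y}(\hat h(\hat x),h(x))\le\epsilon$, and for all $\hat u\in\hat{\mathbb U}$, $\mathbb W=\mathbb W_{\mathbf t}(\cdot\mid\hat u,\hat x,x)$ has marginals $\hat{\mathbf t}(\cdot\mid\hat x,\hat u)$ on $\hat{\mathbb X}$ and $\mathbf t(\cdot\mid x,\mathcal U_v(\hat u,\hat x,x))$ on $\mathbb X$, and $\mathbb W(\mathcal R)\ge1-\delta$. *)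

theory Defs
  imports "HOL-Probability.Probability"
begin

record ('x, 'u, 'y) gmdp =
  init :: 'x
  trans :: "'x \<Rightarrow> 'u \<Rightarrow> 'x measure"
  out :: "'x \<Rightarrow> 'y"

definition gmdp ::
  "('x::polish_space, 'u::polish_space, 'y::metric_space) gmdp \<Rightarrow> bool" where
  "gmdp M \<longleftrightarrow>
     (\<lambda>(x, u). trans M x u) \<in> borel \<rightarrow>\<^sub>M prob_algebra borel \<and>
     out M \<in> borel \<rightarrow>\<^sub>M borel"

definition mix :: "('x, 'u, 'y) gmdp \<Rightarrow> 'x \<Rightarrow> 'u measure \<Rightarrow> 'x measure" where
  "mix M x \<nu> = bind \<nu> (\<lambda>u. trans M x u)"

definition univ_measurable :: "'a measure \<Rightarrow> 'b measure \<Rightarrow> ('a \<Rightarrow> 'b) set" where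
  "univ_measurable M N =
     {f. \<forall>P \<in> space (prob_algebra M). f \<in> completion P \<rightarrow>\<^sub>M N}"

text \<open>A control strategy for a gMDP: a gMDP with (Polish) memory state space, here the reals
 (every Polish space is Borel isomorphic to a Borel subset of the reals), input space the
 state space of the controlled system and output space the probability measures on inputs.
 Execution: u_t ~ cout m_t, x_{t+1} ~ t(. | x_t, u_t), m_{t+1} ~ ctrans m_t x_{t+1}.\<close>

record ('x, 'u) strategy =
  mem0 :: real
  ctrans :: "real \<Rightarrow> 'x \<Rightarrow> real measure"
  cout :: "real \<Rightarrow> 'u measure"

definition strategy :: "('x::polish_space, 'u::polish_space) strategy \<Rightarrow> bool" where
  "strategy C \<longleftrightarrow>
     (\<lambda>(m, x). ctrans C m x) \<in> univ_measurable borel (prob_algebra borel) \<and>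
     cout C \<in> univ_measurable borel (prob_algebra borel)"

datatype 'ap scltl =
    STrue
  | SProp 'ap
  | SNProp 'ap
  | SAnd "'ap scltl" "'ap scltl"
  | SOr "'ap scltl" "'ap scltl"
  | SNext "'ap scltl"
  | SUntil "'ap scltl" "'ap scltl"

fun sat :: "(nat \<Rightarrow> 'ap set) \<Rightarrow> 'ap scltl \<Rightarrow> bool" where
  "sat w STrue = True"
| "sat w (SProp p) = (p \<in> w 0)"
| "sat w (SNProp p) = (p \<notin> w 0)"
| "sat w (SAnd \<phi> \<theta>) = (sat w \<phi> \<and> sat w \<theta>)"
| "sat w (SOr \<phi> \<theta>) = (sat w \<phi> \<or> sat w \<theta>)"
| "sat w (SNext \<phi>) = sat (\<lambda>i. w (Suc i)) \<phi>"
| "sat w (SUntil \<phi> \<theta>) =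
     (\<exists>k. sat (\<lambda>i. w (i + k)) \<theta> \<and> (\<forall>j<k. sat (\<lambda>i. w (i + j)) \<phi>))"

record ('q, 'ap) dfa =
  dq0 :: 'q
  dF :: "'q set"
  dtau :: "'q \<Rightarrow> 'ap set \<Rightarrow> 'q"

fun run :: "('q, 'ap) dfa \<Rightarrow> (nat \<Rightarrow> 'ap set) \<Rightarrow> nat \<Rightarrow> 'q" where
  "run A w 0 = dq0 A"
| "run A w (Suc n) = dtau A (run A w n) (w n)"

definition accepts :: "('q, 'ap) dfa \<Rightarrow> (nat \<Rightarrow> 'ap set) \<Rightarrow> bool" where
  "accepts A w \<longleftrightarrow> (\<exists>n. run A w n \<in> dF A)"

definition good_prefix :: "'ap scltl \<Rightarrow> 'ap set list \<Rightarrow> bool" where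
  "good_prefix \<psi> ws \<longleftrightarrow> (\<forall>w. (\<forall>i<length ws. w i = ws ! i) \<longrightarrow> sat w \<psi>)"

text \<open>cyl_prob C M E n x m ys: probability that the output prefix (ys followed by the next
 n+1 outputs) satisfies E, when the closed loop is in state x with controller memory m.\<close>
fun cyl_prob ::
  "('x, 'u) strategy \<Rightarrow> ('x, 'u, 'y) gmdp \<Rightarrow> ('y list \<Rightarrow> bool) \<Rightarrow> nat \<Rightarrow> 'x \<Rightarrow> real
     \<Rightarrow> 'y list \<Rightarrow> ennreal" where
  "cyl_prob C M E 0 x m ys = (if E (ys @ [out M x]) then 1 else 0)"
| "cyl_prob C M E (Suc n) x m ys =
     (\<integral>\<^sup>+ x'. (\<integral>\<^sup>+ m'. cyl_prob C M E n x' m' (ys @ [out M x]) \<partial>completion (ctrans C m x'))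
        \<partial>completion (mix M x (cout C m)))"

text \<open>P_{C x M}(omega |= psi): measure of the increasing union over n of the events
 "the first n+1 labels form a good prefix" (continuity from below).\<close>
definition sat_prob ::
  "('x, 'u) strategy \<Rightarrow> ('x, 'u, 'y) gmdp \<Rightarrow> ('y \<Rightarrow> 'ap set) \<Rightarrow> 'ap scltl \<Rightarrow> ennreal" where
  "sat_prob C M L \<psi> =
     (SUP n. cyl_prob C M (\<lambda>ys. good_prefix \<psi> (map L ys)) n (init M) (mem0 C) [])"

definition sim_rel ::
  "real \<Rightarrow> real \<Rightarrow> ('xh::polish_space, 'uh::polish_space, 'y::metric_space) gmdp
     \<Rightarrow> ('x::polish_space, 'u::polish_space, 'y) gmdp \<Rightarrow> bool" where
  "sim_rel \<epsilon> \<delta> Mh M \<longleftrightarrow>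
     (\<exists>(Uv :: 'uh \<Rightarrow> 'xh \<Rightarrow> 'x \<Rightarrow> 'u measure) (R :: ('xh \<times> 'x) set)
        (W :: 'uh \<Rightarrow> 'xh \<Rightarrow> 'x \<Rightarrow> ('xh \<times> 'x) measure).
        (\<forall>uh xh x. Uv uh xh x \<in> space (prob_algebra borel)) \<and>
        R \<in> sets borel \<and>
        (\<lambda>(uh, xh, x). W uh xh x) \<in> borel \<rightarrow>\<^sub>M prob_algebra borel \<and>
        (init Mh, init M) \<in> R \<and>
        (\<forall>(xh, x) \<in> R.
           dist (out Mh xh) (out M x) \<le> \<epsilon> \<and>
           (\<forall>uh. distr (W uh xh x) borel fst = trans Mh xh uh \<and>
                 distr (W uh xh x) borel snd = mix M x (Uv uh xh x) \<and>
                 measure (W uh xh x) R \<ge> 1 - \<delta>)))"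

definition markov_policy :: "('xh::polish_space \<times> 'q \<Rightarrow> 'uh::polish_space measure) \<Rightarrow> bool" where
  "markov_policy \<mu> \<longleftrightarrow>
     \<mu> \<in> univ_measurable (borel \<Otimes>\<^sub>M count_space UNIV) (prob_algebra borel)"

definition clamp01 :: "real \<Rightarrow> real" where
  "clamp01 r = min 1 (max 0 r)"

definition tbar ::
  "real \<Rightarrow> ('q, 'ap) dfa \<Rightarrow> ('y::metric_space \<Rightarrow> 'ap set) \<Rightarrow> ('xh, 'uh, 'y) gmdp
     \<Rightarrow> 'q \<Rightarrow> 'xh \<Rightarrow> 'q set" where
  "tbar \<epsilon> A L Mh q xh' = (\<lambda>\<alpha>. dtau A q \<alpha>) ` (L ` {y'. dist y' (out Mh xh') \<le> \<epsilon>})"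

definition indF :: "('q, 'ap) dfa \<Rightarrow> 'q \<Rightarrow> real" where
  "indF A q = (if q \<in> dF A then 1 else 0)"

definition robust_op ::
  "real \<Rightarrow> real \<Rightarrow> ('xh, 'uh, 'y::metric_space) gmdp \<Rightarrow> ('q::finite, 'ap) dfa
     \<Rightarrow> ('y \<Rightarrow> 'ap set) \<Rightarrow> ('xh \<times> 'q \<Rightarrow> 'uh measure)
     \<Rightarrow> ('xh \<Rightarrow> 'q \<Rightarrow> real) \<Rightarrow> ('xh \<Rightarrow> 'q \<Rightarrow> real)" where
  "robust_op \<epsilon> \<delta> Mh A L \<mu> V = (\<lambda>xh q. clamp01 (enn2real
      (\<integral>\<^sup>+ xh'. ennreal (Min ((\<lambda>q'. max (indF A q') (V xh' q')) ` tbar \<epsilon> A L Mh q xh'))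
         \<partial>completion (mix Mh xh (\<mu> (xh, q)))) - \<delta>))"

definition V_inf ::
  "real \<Rightarrow> real \<Rightarrow> ('xh, 'uh, 'y::metric_space) gmdp \<Rightarrow> ('q::finite, 'ap) dfa
     \<Rightarrow> ('y \<Rightarrow> 'ap set) \<Rightarrow> ('xh \<times> 'q \<Rightarrow> 'uh measure) \<Rightarrow> 'xh \<Rightarrow> 'q \<Rightarrow> real" where
  "V_inf \<epsilon> \<delta> Mh A L \<mu> = (\<lambda>xh q. lim (\<lambda>l. (robust_op \<epsilon> \<delta> Mh A L \<mu> ^^ l) (\<lambda>_ _. 0) xh q))"

definition S_value ::
  "real \<Rightarrow> real \<Rightarrow> ('xh, 'uh, 'y::metric_space) gmdp \<Rightarrow> ('q::finite, 'ap) dfa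
     \<Rightarrow> ('y \<Rightarrow> 'ap set) \<Rightarrow> ('xh \<times> 'q \<Rightarrow> 'uh measure) \<Rightarrow> real" where
  "S_value \<epsilon> \<delta> Mh A L \<mu> =
     Min ((\<lambda>q. max (indF A q) (V_inf \<epsilon> \<delta> Mh A L \<mu> (init Mh) q))
            ` tbar \<epsilon> A L Mh (dq0 A) (init Mh))"

end

theory Submission
  imports Defs
begin

text \<open>
  The controller remembers \<open>(xh, x, q)\<close>: a simulated abstract state, the concrete state and the
  automaton state. Averaging the coupling kernel over the policy gives a joint law of the next
  pair \<open>(xh', x')\<close>. The controller applies an input distribution under which \<open>x'\<close> has the correct
  marginal law, observes \<open>x'\<close>, and draws \<open>xh'\<close> from the conditional law given \<open>x'\<close>. As long as the
  pair stays in the relation, the automaton state reached by the concrete labels is one of those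
  the robust operator minimises over, and the relation is lost with probability at most \<open>\<delta>\<close> per
  step. So, by induction, the probability of having accepted within \<open>n\<close> steps dominates the \<open>n\<close>-th
  iterate of the robust operator.

  Two measurability problems have to be solved. The interface of a simulation relation is not
  assumed measurable, so the input distribution is chosen by a Jankov--von Neumann selection. The
  conditional law must depend measurably on the joint law; it is built from its distribution
  function, which is obtained by differentiating measures along a countable base.
\<close>

subsection \<open>Analytic sets and selections\<close>

text \<open>The relation only says that for each \<open>uh\<close> some input law produces the
  second marginal of \<open>W uh xh x\<close>; how that law varies with \<open>uh\<close> is left
  open, so it cannot be averaged over the policy. Instead an input law is selected as a function of
  \<open>x\<close> and of a code of the wanted next-state law, out of a Borel relation; the given
  interface only shows that the relation has a solution. The selection is universally measurable,
  which is the regularity that strategies allow. The joint law depends on the memory through the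
  policy, hence only universally measurably. The conditional law is therefore one Borel map of the
  pair (joint law, observed state), which can be composed with that dependence. Densities chosen by
  Radon-Nikodym separately for each joint law would carry no regularity in the law. Points and
  probability measures are coded by reals because memories are reals and because laws on the line
  can be generated by quantile functions.\<close>

definition analytic :: "'a::topological_space set \<Rightarrow> bool" where
  "analytic A \<longleftrightarrow> (\<exists>C :: ('a \<times> (nat \<Rightarrow> nat)) set. closed C \<and> A = fst ` C)"

lemma closed_imp_analytic: "closed A \<Longrightarrow> analytic A"
  unfolding analytic_def
  by (rule exI[of _ "A \<times> UNIV"]) (auto simp: closed_Times)

lemma continuous_on_snd_coordinate:
  "continuous_on UNIV (\<lambda>p :: 'a::topological_space \<times> (nat \<Rightarrow> nat). snd p i)"
  by (rule continuous_on_compose2[OF continuous_on_product_coordinates[of i]])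
     (auto intro: continuous_intros)

lemma continuous_on_reindex:
  "continuous_on UNIV (\<lambda>p :: 'a::topological_space \<times> (nat \<Rightarrow> nat). (fst p, \<lambda>i. snd p (f i)))"
  by (intro continuous_on_Pair continuous_on_fst continuous_on_id
      continuous_on_coordinatewise_then_product continuous_on_snd_coordinate)

text \<open>Entry 0 of the new sequence names a set of the family, and the shifted sequence is the
  witness for that set.\<close>

lemma analytic_UN:
  fixes A :: "nat \<Rightarrow> 'a::topological_space set"
  assumes "\<And>n. analytic (A n)"
  shows "analytic (\<Union>n. A n)"
proof -
  have "\<forall>n. \<exists>C :: ('a \<times> (nat \<Rightarrow> nat)) set. closed C \<and> A n = fst ` C"
    using assms by (simp add: analytic_def)
  then obtain C :: "nat \<Rightarrow> ('a \<times> (nat \<Rightarrow> nat)) set"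
    where C: "\<And>n. closed (C n)" "\<And>n. A n = fst ` C n" by metis
  let ?S = "\<lambda>p :: 'a \<times> (nat \<Rightarrow> nat). (fst p, \<lambda>i. snd p (Suc i))"
  \<comment> \<open>"The tail is a witness for the set named by entry 0", written as an intersection
    of implications so that it is visibly closed.\<close>
  let ?D = "\<Inter>n. ((\<lambda>p. snd p 0) -` (- {n})) \<union> (?S -` C n)"
  have "closed ?D"
    by (intro closed_INT ballI closed_Un closed_vimage C(1) continuous_on_reindex
        continuous_on_snd_coordinate) (simp_all add: closed_def discrete_topology_class.open_discrete)
  moreover have "(\<Union>n. A n) = fst ` ?D"
  proof (intro equalityI subsetI)
    fix x assume "x \<in> (\<Union>n. A n)"
    then obtain n s where "(x, s) \<in> C n" using C(2) by force
    then have "(x, \<lambda>i. case i of 0 \<Rightarrow> n | Suc j \<Rightarrow> s j) \<in> ?D" by auto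
    then show "x \<in> fst ` ?D" by (metis (no_types) fst_conv image_eqI)
  next
    fix x assume "x \<in> fst ` ?D"
    then obtain s where "(x, s) \<in> ?D" by auto
    then have "(x, \<lambda>i. s (Suc i)) \<in> C (s 0)" by auto
    then show "x \<in> (\<Union>n. A n)" using C(2) by force
  qed
  ultimately show ?thesis unfolding analytic_def by blast
qed

text \<open>One sequence stores a witness for every set of the family, interleaved by the pairing
  function.\<close>

lemma analytic_INT:
  fixes A :: "nat \<Rightarrow> 'a::topological_space set"
  assumes "\<And>n. analytic (A n)"
  shows "analytic (\<Inter>n. A n)"
proof -
  have "\<forall>n. \<exists>C :: ('a \<times> (nat \<Rightarrow> nat)) set. closed C \<and> A n = fst ` C"
    using assms by (simp add: analytic_def)
  then obtain C :: "nat \<Rightarrow> ('a \<times> (nat \<Rightarrow> nat)) set"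
    where C: "\<And>n. closed (C n)" "\<And>n. A n = fst ` C n" by metis
  let ?S = "\<lambda>n (p :: 'a \<times> (nat \<Rightarrow> nat)). (fst p, \<lambda>i. snd p (prod_encode (n, i)))"
  let ?D = "\<Inter>n. ?S n -` C n"
  have "closed ?D"
    by (intro closed_INT ballI closed_vimage C(1) continuous_on_reindex)
  moreover have "(\<Inter>n. A n) = fst ` ?D"
  proof (intro equalityI subsetI)
    fix x assume "x \<in> (\<Inter>n. A n)"
    then have "\<forall>n. \<exists>s. (x, s) \<in> C n" using C(2) by force
    then obtain s where "\<And>n. (x, s n) \<in> C n" by metis
    then have "(x, \<lambda>i. case prod_decode i of (n, j) \<Rightarrow> s n j) \<in> ?D" by auto
    then show "x \<in> fst ` ?D" by (metis (no_types) fst_conv image_eqI)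
  next
    fix x assume "x \<in> fst ` ?D"
    then obtain s where "(x, s) \<in> ?D" by auto
    then have "(x, \<lambda>i. s (prod_encode (n, i))) \<in> C n" for n by auto
    then show "x \<in> (\<Inter>n. A n)" using C(2) by force
  qed
  ultimately show ?thesis unfolding analytic_def by blast
qed

text \<open>In a metric space an open set is a countable union of closed sets, namely of the points
  at distance at least 1/(n+1) from the complement.\<close>

lemma open_imp_analytic:
  fixes U :: "'a::metric_space set"
  assumes "open U"
  shows "analytic U"
proof -
  let ?F = "\<lambda>n. {x. ball x (1 / real (Suc n)) \<subseteq> U}"
  have "- ?F n = (\<Union>y\<in>-U. ball y (1 / real (Suc n)))" for n
    by (auto simp: subset_iff dist_commute)
  then have "closed (?F n)" for n by (simp add: closed_def open_UN)
  moreover have "U = (\<Union>n. ?F n)"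
  proof (intro equalityI subsetI)
    fix x assume "x \<in> U"
    then obtain e where e: "e > 0" "ball x e \<subseteq> U" using assms by (meson openE)
    then obtain n where "1 / real (Suc n) < e" using nat_approx_posE by metis
    then have "x \<in> ?F n" using e(2) by (auto simp: subset_iff)
    then show "x \<in> (\<Union>n. ?F n)" by blast
  next
    fix x assume "x \<in> (\<Union>n. ?F n)"
    then obtain n where "ball x (1 / real (Suc n)) \<subseteq> U" by auto
    then show "x \<in> U" using centre_in_ball[of x "1 / real (Suc n)"] by auto
  qed
  ultimately show ?thesis by (metis (no_types, lifting) analytic_UN closed_imp_analytic)
qed

lemma analytic_vimage_fst:
  assumes "analytic (A :: 'a::topological_space set)"
  shows "analytic (fst -` A :: ('a \<times> 'b::topological_space) set)"
proof -
  obtain C :: "('a \<times> (nat \<Rightarrow> nat)) set" where C: "closed C" "A = fst ` C"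
    using assms by (auto simp: analytic_def)
  let ?D = "(\<lambda>p :: ('a \<times> 'b) \<times> (nat \<Rightarrow> nat). (fst (fst p), snd p)) -` C"
  have "closed ?D" by (intro closed_vimage C continuous_intros)
  moreover have "fst -` A = fst ` ?D"
  proof (intro equalityI subsetI)
    fix p :: "'a \<times> 'b" assume "p \<in> fst -` A"
    then obtain f where "(fst p, f) \<in> C" using C(2) by auto
    then have "(p, f) \<in> ?D" by simp
    then show "p \<in> fst ` ?D" by (rule image_eqI[rotated]) simp
  qed (use C(2) in \<open>auto intro: rev_image_eqI\<close>)
  ultimately show ?thesis unfolding analytic_def by blast
qed

text \<open>The sets which are analytic together with their complement form a \<open>\<sigma>\<close>-algebra, and both
  projections are measurable for it; hence it contains all Borel sets.\<close>

lemma borel_imp_analytic: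
  fixes B :: "('a::{metric_space, second_countable_topology} \<times> (nat \<Rightarrow> nat)) set"
  assumes "B \<in> sets borel"
  shows "analytic B"
proof -
  let ?A = "{B :: ('a \<times> (nat \<Rightarrow> nat)) set. analytic B \<and> analytic (- B)}"
  have "sigma_algebra UNIV ?A"
    unfolding sigma_algebra_iff2
  proof (intro conjI ballI allI impI)
    show "{} \<in> ?A" by (simp add: closed_imp_analytic)
    show "UNIV - s \<in> ?A" if "s \<in> ?A" for s using that by (simp flip: Compl_eq_Diff_UNIV)
    show "\<Union> (range X) \<in> ?A" if "range X \<subseteq> ?A" for X :: "nat \<Rightarrow> _"
    proof -
      have "analytic (\<Union>n. X n)" "analytic (\<Inter>n. - X n)"
        using that by (intro analytic_UN analytic_INT; auto)+
      then show ?thesis by (simp add: Compl_UN)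
    qed
  qed auto
  then interpret sigma_algebra UNIV ?A .
  let ?M = "sigma UNIV ?A"
  have sets: "sets ?M = ?A" by (rule sets_measure_of_eq)
  have "fst \<in> ?M \<rightarrow>\<^sub>M borel"
  proof (rule borel_measurableI)
    fix S :: "'a set" assume "open S"
    then have "analytic S" "analytic (- S)" by (auto intro: open_imp_analytic closed_imp_analytic)
    then have "fst -` S \<in> ?A"
      using analytic_vimage_fst[of S] analytic_vimage_fst[of "- S"] by (auto simp: vimage_Compl)
    then show "fst -` S \<inter> space ?M \<in> sets ?M" by (simp add: sets)
  qed
  moreover have "snd \<in> ?M \<rightarrow>\<^sub>M borel"
  proof (rule measurable_coordinatewise_then_product)
    fix i
    show "(\<lambda>x. snd x i) \<in> ?M \<rightarrow>\<^sub>M borel"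
    proof (rule borel_measurableI)
      fix S :: "nat set"
      have "analytic ((\<lambda>x. snd x i) -` S :: ('a \<times> (nat \<Rightarrow> nat)) set)" for S :: "nat set"
        by (intro closed_imp_analytic closed_vimage continuous_on_snd_coordinate)
           (simp_all add: closed_def discrete_topology_class.open_discrete)
      from this[of S] this[of "- S"] show "(\<lambda>x. snd x i) -` S \<inter> space ?M \<in> sets ?M"
        by (simp add: sets vimage_Compl)
    qed
  qed
  ultimately have "(\<lambda>x. (fst x, snd x)) \<in> ?M \<rightarrow>\<^sub>M borel \<Otimes>\<^sub>M borel" by (rule measurable_Pair)
  \<comment> \<open>Second countability enters here: the product of the two Borel \<sigma>-algebras
    is the Borel \<sigma>-algebra of the product, so measurable projections suffice.\<close>
  then have "(\<lambda>x. x) \<in> ?M \<rightarrow>\<^sub>M borel" by (simp add: borel_prod)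
  from measurable_sets[OF this assms] show ?thesis by (simp add: sets)
qed

section \<open>Universal measurability of analytic sets\<close>

lemma tendsto_coordinatewise:
  fixes f :: "'b \<Rightarrow> 'i \<Rightarrow> 'a::topological_space"
  assumes "\<And>i. ((\<lambda>n. f n i) \<longlongrightarrow> l i) F"
  shows "(f \<longlongrightarrow> l) F"
  using assms limitin_componentwise[of "\<lambda>_. euclidean" UNIV f l F]
  by (simp add: euclidean_product_topology)

lemma compact_bounded_sequences: "compact {s :: nat \<Rightarrow> nat. \<forall>i. s i \<le> m i}"
proof -
  have "compactin (product_topology (\<lambda>i. euclidean) UNIV) (PiE UNIV (\<lambda>i. {..m i}))"
    by (subst compactin_PiE) (auto intro: finite_imp_compact)
  then show ?thesis by (simp add: euclidean_product_topology PiE_def Pi_def)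
qed

text \<open>Choquet's capacitability argument. All coordinates of the witness are bounded while the
  outer measure stays above \<open>t\<close>. The bounded witnesses form a compact set, which is why
  the intersection of the closures of the projections still lies inside the projection.\<close>

lemma analytic_inner_approx:
  fixes C :: "('a::metric_space \<times> (nat \<Rightarrow> nat)) set"
  assumes C: "closed C" and P: "sets P = sets borel" "finite_measure P"
    and t: "t < outer_measure_of P (fst ` C)"
  obtains B where "B \<in> sets P" "B \<subseteq> fst ` C" "t \<le> emeasure P B"
proof -
  interpret finite_measure P by fact
  have sp: "space P = UNIV" using P(1) sets_eq_imp_space_eq by fastforce
  define E where "E k m = fst ` {p \<in> C. \<forall>i<k. snd p i \<le> m i}" for k and m :: "nat \<Rightarrow> nat"
  have E_cong: "E k m = E k m'" if "\<And>i. i < k \<Longrightarrow> m i = m' i" for k m m'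
    using that by (auto simp: E_def)
  \<comment> \<open>Coordinates are bounded one at a time. As the bound on coordinate
    \<open>k\<close> grows, the sets increase to the set without that bound, so some finite bound
    keeps the outer measure above \<open>t\<close>; the strict inequality leaves room for the next
    coordinate.\<close>
  have "\<exists>m. \<forall>n. t < outer_measure_of P (E n (m n)) \<and> (\<forall>i<n. m (Suc n) i = m n i)"
  proof (rule dependent_nat_choice)
    show "\<exists>m. t < outer_measure_of P (E 0 m)" using t by (simp add: E_def)
    fix m k assume m: "t < outer_measure_of P (E k m)"
    have U: "(\<Union>j. E (Suc k) (m(k := j))) = E k m"
      by (force simp: E_def less_Suc_eq)
    have "(SUP j. outer_measure_of P (E (Suc k) (m(k := j)))) = outer_measure_of P (E k m)"
      unfolding U[symmetric]
      by (rule SUP_outer_measure_of_incseq)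
         (auto simp: sp incseq_def E_def less_Suc_eq intro!: image_mono intro: order_trans)
    with m obtain j where "t < outer_measure_of P (E (Suc k) (m(k := j)))"
      by (metis less_SUP_iff)
    then show "\<exists>m'. t < outer_measure_of P (E (Suc k) m') \<and> (\<forall>i<k. m' i = m i)"
      by (intro exI[of _ "m(k := j)"]) auto
  qed
  then obtain f where f: "\<And>n. t < outer_measure_of P (E n (f n))"
    "\<And>n i. i < n \<Longrightarrow> f (Suc n) i = f n i" by blast
  \<comment> \<open>The bound on coordinate \<open>i\<close> is final from stage
    \<open>Suc i\<close> on, so the diagonal collects all of them.\<close>
  define m where "m i = f (Suc i) i" for i
  have fm: "i < n \<Longrightarrow> f n i = m i" for n i
  proof (induction n)
    case (Suc n) then show ?case using f(2)[of i n] by (cases "i = n") (auto simp: m_def)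
  qed simp
  have Em: "t < outer_measure_of P (E n m)" for n
    using f(1)[of n] E_cong[of n "f n" m] fm by simp
  define B where "B = (\<Inter>n. closure (E n m))"
  have Bsets: "B \<in> sets P" unfolding B_def P(1) by auto
  have "(INF n. emeasure P (closure (E n m))) = emeasure P B"
    unfolding B_def
  proof (rule INF_emeasure_decseq)
    show "decseq (\<lambda>n. closure (E n m))"
      by (auto simp: decseq_def E_def intro!: closure_mono image_mono)
  qed (auto simp: P(1))
  moreover have "t \<le> emeasure P (closure (E n m))" for n
  proof -
    have "outer_measure_of P (E n m) \<le> outer_measure_of P (closure (E n m))"
      by (rule outer_measure_of_mono) (rule closure_subset)
    also have "\<dots> = emeasure P (closure (E n m))" by (simp add: P(1))
    finally show ?thesis using Em[of n] by simp
  qed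
  ultimately have tB: "t \<le> emeasure P B" by (metis INF_greatest)
  have "B \<subseteq> fst ` C"
  proof
    fix z assume "z \<in> B"
    then have "\<forall>n. \<exists>p. p \<in> C \<and> (\<forall>i<n. snd p i \<le> m i) \<and> dist (fst p) z < 1 / real (Suc n)"
      by (force simp: B_def E_def closure_approachable)
    then obtain p where p: "\<And>n. p n \<in> C" "\<And>n i. i < n \<Longrightarrow> snd (p n) i \<le> m i"
      "\<And>n. dist (fst (p n)) z < 1 / real (Suc n)" by metis
    \<comment> \<open>Only the first \<open>n\<close> entries of the \<open>n\<close>-th witness are
      known to be bounded. Truncation puts it into the compact set, and each fixed coordinate is
      eventually unaffected.\<close>
    let ?s = "\<lambda>n i. min (snd (p n) i) (m i)"
    have "seq_compact {s. \<forall>i. s i \<le> m i}"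
      by (rule compact_imp_seq_compact[OF compact_bounded_sequences])
    then obtain l r where r: "strict_mono r" "(?s \<circ> r) \<longlonglongrightarrow> l"
      by (rule seq_compactE[where f = ?s]) auto
    have "(\<lambda>n. snd (p (r n))) \<longlonglongrightarrow> l"
    proof (rule tendsto_coordinatewise)
      fix i
      have "continuous_on UNIV (\<lambda>s :: nat \<Rightarrow> nat. s i)" by simp
      then have "(\<lambda>n. (?s \<circ> r) n i) \<longlonglongrightarrow> l i"
        by (rule continuous_on_tendsto_compose[OF _ r(2)]) auto
      moreover have "\<forall>\<^sub>F n in sequentially. (?s \<circ> r) n i = snd (p (r n)) i"
        using eventually_gt_at_top[of i]
      proof eventually_elim
        case (elim n)
        then have "i < r n" using seq_suble[OF r(1), of n] by simp
        then show ?case using p(2) by auto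
      qed
      ultimately show "(\<lambda>n. snd (p (r n)) i) \<longlonglongrightarrow> l i" by (rule Lim_transform_eventually)
    qed
    moreover have "(\<lambda>n. fst (p (r n))) \<longlonglongrightarrow> z"
    proof -
      have "(\<lambda>n. dist (fst (p n)) z) \<longlonglongrightarrow> 0"
        by (rule Lim_null_comparison[OF _ LIMSEQ_inverse_real_of_nat])
           (use p(3) in \<open>simp add: inverse_eq_divide less_imp_le del: of_nat_Suc\<close>)
      then have "(\<lambda>n. fst (p n)) \<longlonglongrightarrow> z" by (rule tendsto_dist_iff[THEN iffD2])
      from LIMSEQ_subseq_LIMSEQ[OF this r(1)] show ?thesis by (simp add: o_def)
    qed
    ultimately have "(\<lambda>n. (fst (p (r n)), snd (p (r n)))) \<longlonglongrightarrow> (z, l)"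
      by (intro tendsto_Pair)
    then have "(\<lambda>n. p (r n)) \<longlonglongrightarrow> (z, l)" by simp
    then have "(z, l) \<in> C" using C p(1) by (metis closed_sequentially)
    then show "z \<in> fst ` C" by force
  qed
  from that[OF Bsets this tB] show thesis .
qed

text \<open>Inner approximation yields a Borel subset carrying the whole outer measure of
  \<open>A\<close>, and a measurable hull has the same measure. \<open>A\<close> lies between the
  two, and their difference is null.\<close>

lemma analytic_in_completion:
  fixes A :: "'a::metric_space set"
  assumes A: "analytic A" and P: "sets P = sets borel" "finite_measure P"
  shows "A \<in> sets (completion P)"
proof -
  interpret finite_measure P by fact
  have sp: "space P = UNIV" using P(1) sets_eq_imp_space_eq by fastforce
  obtain C :: "('a \<times> (nat \<Rightarrow> nat)) set" where C: "closed C" "A = fst ` C"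
    using A by (auto simp: analytic_def)
  have "\<exists>B. B \<in> sets P \<and> B \<subseteq> A \<and> outer_measure_of P A \<le> emeasure P B"
  proof (cases "outer_measure_of P A = 0")
    case True then show ?thesis by (intro exI[of _ "{}"]) auto
  next
    case False
    then have "0 < outer_measure_of P A" by (simp add: zero_less_iff_neq_zero)
    from approx_from_below_dense_linorder[OF this]
    obtain u where u: "\<And>n. u n < outer_measure_of P A" "u \<longlonglongrightarrow> outer_measure_of P A" by blast
    have "\<forall>n. \<exists>B. B \<in> sets P \<and> B \<subseteq> A \<and> u n \<le> emeasure P B"
      using analytic_inner_approx[OF C(1) P] u(1) unfolding C(2) by metis
    then obtain B where B: "\<And>n. B n \<in> sets P" "\<And>n. B n \<subseteq> A" "\<And>n. u n \<le> emeasure P (B n)"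
      by metis
    have "u n \<le> emeasure P (\<Union>n. B n)" for n
      by (rule order_trans[OF B(3)]) (intro emeasure_mono, auto intro: B(1))
    then have "outer_measure_of P A \<le> emeasure P (\<Union>n. B n)"
      by (intro LIMSEQ_le_const2[OF u(2)]) auto
    then show ?thesis using B by (intro exI[of _ "\<Union>n. B n"]) auto
  qed
  then obtain B where B: "B \<in> sets P" "B \<subseteq> A" "outer_measure_of P A \<le> emeasure P B" by blast
  obtain H where H: "H \<in> sets P" "A \<subseteq> H" "outer_measure_of P A = emeasure P H"
    using outer_measure_of_attain[of A P] by (auto simp: sp)
  have "H - B \<in> null_sets P"
  proof (rule null_setsI)
    have "emeasure P (H - B) = emeasure P H - emeasure P B"
      using B H by (intro emeasure_Diff) auto
    also have "\<dots> = 0" using B(3) H(3) by (simp add: diff_eq_0_iff_ennreal emeasure_eq_measure)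
    finally show "emeasure P (H - B) = 0" .
  qed (use B H in auto)
  then have "B \<union> (A - B) \<in> sets (completion P)"
    using B H by (intro sets_completionI[OF refl _ _ B(1), of _ "H - B"]) auto
  then show ?thesis using B(2) by (simp add: Un_absorb1)
qed

text \<open>The lexicographically least witness is chosen: each entry is the least one that keeps
  the prefix extendable. Extendability is an analytic condition, so every entry is universally
  measurable; closedness of \<open>C\<close> keeps the limit in \<open>C\<close>.\<close>

lemma closed_lexicographic_selection:
  fixes C :: "('a::metric_space \<times> (nat \<Rightarrow> nat)) set"
  assumes "closed C"
  obtains s where "s \<in> univ_measurable borel borel" "\<And>z. z \<in> fst ` C \<Longrightarrow> (z, s z) \<in> C"
proof -
  define E where "E t = {z. \<exists>f. (z, f) \<in> C \<and> (\<forall>i<length t. f i = t ! i)}" for t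
  define pre where "pre z k = rec_nat [] (\<lambda>_ t. t @ [LEAST j. z \<in> E (t @ [j])]) k" for z and k :: nat
  have pre_simps: "pre z 0 = []" "pre z (Suc k) = pre z k @ [LEAST j. z \<in> E (pre z k @ [j])]" for z k
    by (simp_all add: pre_def)
  have len: "length (pre z k) = k" for z k by (induction k) (auto simp: pre_simps)
  define s where "s z k = pre z (Suc k) ! k" for z k
  have pre_nth: "i < k \<Longrightarrow> pre z k ! i = s z i" for z i k
  proof (induction k)
    case (Suc k)
    show ?case
    proof (cases "i = k")
      case False
      then have "i < k" using Suc by simp
      then show ?thesis using Suc.IH by (simp add: pre_simps(2) nth_append len)
    qed (simp add: s_def)
  qed simp
  have E_analytic: "analytic (E t)" for t
  proof -
    have eq: "C \<inter> (\<Inter>i\<in>{..<length t}. (\<lambda>p. snd p i) -` {t ! i})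
        = {p \<in> C. \<forall>i<length t. snd p i = t ! i}" by auto
    have "closed {p \<in> C. \<forall>i<length t. snd p i = t ! i}"
      unfolding eq[symmetric]
      by (intro closed_Int assms closed_INT ballI closed_vimage continuous_on_snd_coordinate)
         (simp_all add: closed_def discrete_topology_class.open_discrete)
    moreover have "E t = fst ` {p \<in> C. \<forall>i<length t. snd p i = t ! i}"
      unfolding E_def image_def by (auto simp: Bex_def)
    ultimately show ?thesis unfolding analytic_def by blast
  qed
  have "s \<in> univ_measurable borel borel"
    unfolding univ_measurable_def
  proof (intro CollectI ballI measurable_coordinatewise_then_product)
    fix P :: "'a measure" and k assume "P \<in> space (prob_algebra borel)"
    then have P: "sets P = sets borel" "finite_measure P"
      by (auto simp: space_prob_algebra prob_space_def)
    have [measurable]: "E t \<in> sets (completion P)" for t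
      by (rule analytic_in_completion[OF E_analytic P])
    have sp: "space P = UNIV" using P(1) sets_eq_imp_space_eq by fastforce
    have [measurable]: "Measurable.pred (completion P) (\<lambda>z. z \<in> E t)" for t
      by (simp add: pred_def sp)
    have pre_meas: "(\<lambda>z. pre z k) \<in> completion P \<rightarrow>\<^sub>M count_space UNIV" for k
    proof (induction k)
      case (Suc k)
      have "(\<lambda>z. t @ [LEAST j. z \<in> E (t @ [j])]) \<in> completion P \<rightarrow>\<^sub>M count_space UNIV" for t
        by measurable
      from measurable_compose_countable[OF this Suc] show ?case by (simp add: pre_simps)
    qed (simp add: pre_simps)
    have "(\<lambda>z. s z k) \<in> completion P \<rightarrow>\<^sub>M count_space UNIV"
      unfolding s_def by (rule measurable_compose[OF pre_meas]) simp
    then show "(\<lambda>z. s z k) \<in> completion P \<rightarrow>\<^sub>M borel"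
      by (rule measurable_compose) (simp add: borel_measurable_count_space)
  qed
  moreover have "(z, s z) \<in> C" if z: "z \<in> fst ` C" for z
  proof -
    have "z \<in> E (pre z k)" for k
    proof (induction k)
      case 0 then show ?case using z by (auto simp: E_def pre_simps)
    next
      case (Suc k)
      then obtain f where f: "(z, f) \<in> C" "\<forall>i<k. f i = pre z k ! i" by (auto simp: E_def len)
      then have "z \<in> E (pre z k @ [f k])"
        by (auto simp: E_def len nth_append less_Suc_eq intro!: exI[of _ f])
      then show ?case unfolding pre_simps by (rule LeastI)
    qed
    then have "\<forall>k. \<exists>f. (z, f) \<in> C \<and> (\<forall>i<k. f i = s z i)"
      by (simp add: E_def len pre_nth cong: conj_cong)
    then obtain f where f: "\<And>k. (z, f k) \<in> C" "\<And>k i. i < k \<Longrightarrow> f k i = s z i" by metis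
    have "f \<longlonglongrightarrow> s z"
    proof (rule tendsto_coordinatewise)
      fix i
      show "(\<lambda>n. f n i) \<longlonglongrightarrow> s z i"
        by (rule tendsto_eventually, rule eventually_mono[OF eventually_gt_at_top[of i]]) (rule f(2))
    qed
    then have "(\<lambda>k. (z, f k)) \<longlonglongrightarrow> (z, s z)" by (intro tendsto_Pair) auto
    then show ?thesis using assms f(1) by (metis closed_sequentially)
  qed
  ultimately show thesis by (rule that)
qed

text \<open>\<open>G\<close> is itself a projection of a closed set. The sequence \<open>f\<close>
  and the witness for membership in \<open>G\<close> are merged into even and odd entries, selected
  together, and the even entries are kept.\<close>

lemma borel_sequence_selection:
  fixes G :: "('a::{metric_space, second_countable_topology} \<times> (nat \<Rightarrow> nat)) set"
  assumes "G \<in> sets borel"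
  obtains s where "s \<in> univ_measurable borel borel" "\<And>z f. (z, f) \<in> G \<Longrightarrow> (z, s z) \<in> G"
proof -
  obtain C :: "(('a \<times> (nat \<Rightarrow> nat)) \<times> (nat \<Rightarrow> nat)) set" where C: "closed C" "G = fst ` C"
    using borel_imp_analytic[OF assms] by (auto simp: analytic_def)
  let ?h = "\<lambda>p :: 'a \<times> (nat \<Rightarrow> nat). ((fst p, \<lambda>i. snd p (2 * i)), \<lambda>i. snd p (Suc (2 * i)))"
  have "continuous_on UNIV ?h"
    by (intro continuous_on_Pair continuous_on_fst continuous_on_id
        continuous_on_coordinatewise_then_product continuous_on_snd_coordinate)
  then have "closed (?h -` C)" by (intro closed_vimage C)
  then obtain s where s: "s \<in> univ_measurable borel borel"
    "\<And>z. z \<in> fst ` (?h -` C) \<Longrightarrow> (z, s z) \<in> ?h -` C"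
    using closed_lexicographic_selection by blast
  show thesis
  proof (rule that)
    have "(\<lambda>f :: nat \<Rightarrow> nat. \<lambda>i. f (2 * i)) \<in> borel \<rightarrow>\<^sub>M borel"
      by (intro measurable_coordinatewise_then_product measurable_product_coordinates)
    then show "(\<lambda>z i. s z (2 * i)) \<in> univ_measurable borel borel"
      using s(1) by (auto simp: univ_measurable_def intro: measurable_compose)
    fix z f assume "(z, f) \<in> G"
    then obtain g where "((z, f), g) \<in> C" using C(2) by auto
    then have "(z, \<lambda>i. if even i then f (i div 2) else g (i div 2)) \<in> ?h -` C" by simp
    then have "(z, s z) \<in> ?h -` C" by (intro s(2)) (rule image_eqI[rotated], assumption, simp)
    then show "(z, \<lambda>i. s z (2 * i)) \<in> G" using C(2) by force
  qed
qed

subsection \<open>Borel codes by real numbers\<close>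

text \<open>Base 3 with digits 0 and 2: the leading digit decides whether the sum is at most 1/3 or
  at least 2/3, so the digits can be read back without the ambiguity of binary expansions.\<close>

definition cantor :: "(nat \<Rightarrow> bool) \<Rightarrow> real" where
  "cantor b = (\<Sum>n. (if b n then 2 else 0) / 3 ^ Suc n)"

text \<open>The iterated map multiplies by 3 and drops the leading digit, so it shifts the digit
  sequence of a code; it makes sense for every real.\<close>

definition cantor_digit :: "real \<Rightarrow> nat \<Rightarrow> bool" where
  "cantor_digit r n \<longleftrightarrow> 1 / 2 < ((\<lambda>r. 3 * r - (if 1 / 2 < r then 2 else 0)) ^^ n) r"

lemma cantor_sums: "(\<lambda>n. 2 / 3 ^ Suc n :: real) sums 1"
proof -
  have "(\<lambda>n. (2 / 3) * (1 / 3) ^ n :: real) sums ((2 / 3) * (1 / (1 - 1 / 3)))"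
    by (intro sums_mult geometric_sums) auto
  then show ?thesis by (simp add: power_one_over)
qed

lemma cantor_summable: "summable (\<lambda>n. (if b n then 2 else 0) / 3 ^ Suc n :: real)"
  by (rule summable_comparison_test'[OF sums_summable[OF cantor_sums], of 0]) auto

lemma cantor_nonneg: "0 \<le> cantor b"
  unfolding cantor_def by (intro suminf_nonneg cantor_summable) auto

lemma cantor_le_1: "cantor b \<le> 1"
proof -
  have "cantor b \<le> (\<Sum>n. 2 / 3 ^ Suc n)"
    unfolding cantor_def
    by (intro suminf_le cantor_summable sums_summable[OF cantor_sums]) (auto simp: divide_right_mono)
  then show ?thesis using sums_unique[OF cantor_sums] by simp
qed

lemma cantor_split: "3 * cantor b = (if b 0 then 2 else 0) + cantor (\<lambda>n. b (Suc n))"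
proof -
  have "cantor b = (\<Sum>n. (if b (Suc n) then 2 else 0) / 3 ^ Suc (Suc n)) + (if b 0 then 2 else 0) / 3"
    unfolding cantor_def using suminf_split_head[OF cantor_summable[of b]] by simp
  also have "(\<Sum>n. (if b (Suc n) then 2 else 0) / 3 ^ Suc (Suc n) :: real)
      = (\<Sum>n. ((if b (Suc n) then 2 else 0) / 3 ^ Suc n) / 3)" by (simp add: field_simps)
  also have "\<dots> = cantor (\<lambda>n. b (Suc n)) / 3"
    unfolding cantor_def by (rule suminf_divide[OF cantor_summable])
  finally show ?thesis by simp
qed

lemma cantor_first_digit: "1 / 2 < cantor b \<longleftrightarrow> b 0"
  using cantor_split[of b] cantor_nonneg[of "\<lambda>n. b (Suc n)"] cantor_le_1[of "\<lambda>n. b (Suc n)"]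
  by (auto split: if_splits)

lemma cantor_digit_cantor [simp]: "cantor_digit (cantor b) n = b n"
proof -
  have "((\<lambda>r. 3 * r - (if 1 / 2 < r then 2 else 0)) ^^ n) (cantor b) = cantor (\<lambda>k. b (k + n))"
  proof (induction n)
    case (Suc n)
    then show ?case
      using cantor_split[of "\<lambda>k. b (k + n)"] cantor_first_digit[of "\<lambda>k. b (k + n)"] by simp
  qed simp
  then show ?thesis by (simp only: cantor_digit_def cantor_first_digit add_0)
qed

lemma measurable_cantor:
  assumes [measurable]: "\<And>n. Measurable.pred M (\<lambda>x. b x n)"
  shows "(\<lambda>x. cantor (b x)) \<in> borel_measurable M"
  unfolding cantor_def by measurable

lemma measurable_cantor_digit [measurable]: "Measurable.pred borel (\<lambda>r. cantor_digit r n)"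
proof -
  have "((\<lambda>r. 3 * r - (if 1 / 2 < r then 2 else 0)) ^^ n) \<in> borel_measurable (borel :: real measure)"
  proof (induction n)
    case (Suc n)
    have "(\<lambda>r. 3 * r - (if 1 / 2 < r then 2 else 0)) \<in> borel_measurable (borel :: real measure)"
      by measurable
    from measurable_comp[OF Suc this] show ?case by simp
  qed simp
  then show ?thesis unfolding cantor_digit_def by measurable
qed

section \<open>Codes for points of Polish spaces\<close>

instance prod :: (polish_space, polish_space) polish_space ..

definition dense_seq :: "nat \<Rightarrow> 'a::polish_space" where
  "dense_seq = (SOME d. \<forall>U. open U \<longrightarrow> U \<noteq> {} \<longrightarrow> (\<exists>n. d n \<in> U))"

lemma dense_seq:
  assumes "open U" "U \<noteq> {}"
  shows "\<exists>n. (dense_seq n :: 'a::polish_space) \<in> U"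
proof -
  obtain D :: "'a set" where D: "countable D" "\<And>U. open U \<Longrightarrow> U \<noteq> {} \<Longrightarrow> \<exists>d\<in>D. d \<in> U"
    using countable_dense_setE by blast
  have "\<forall>U. open U \<longrightarrow> U \<noteq> {} \<longrightarrow> (\<exists>n. from_nat_into D n \<in> U)"
    using D from_nat_into_surj by metis
  from someI[of "\<lambda>d. \<forall>U. open U \<longrightarrow> U \<noteq> {} \<longrightarrow> (\<exists>n. d n \<in> U)", OF this] assms
  show ?thesis unfolding dense_seq_def by blast
qed

text \<open>Each digit is an open condition on \<open>z\<close>, which makes the code Borel, and
  together the digits locate \<open>z\<close> to any precision. Codes lie in [0, 1], where
  \<open>quant\<close> takes its values.\<close>

definition enc :: "'a::polish_space \<Rightarrow> real" where
  "enc z = cantor (\<lambda>i. case prod_decode i of (j, k) \<Rightarrow> dist (dense_seq j) z < (1 / 2) ^ k)"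

definition dec_approx :: "real \<Rightarrow> nat \<Rightarrow> 'a::polish_space" where
  "dec_approx r k = dense_seq (LEAST j. cantor_digit r (prod_encode (j, k)))"

text \<open>The default value makes decoding total, and the case distinction is Borel because being
  Cauchy is a Borel condition on \<open>r\<close>.\<close>

definition dec :: "real \<Rightarrow> 'a::polish_space" where
  "dec r = (if Cauchy (dec_approx r :: nat \<Rightarrow> 'a) then lim (dec_approx r) else dense_seq 0)"

lemma enc_nonneg: "0 \<le> enc z" and enc_le_1: "enc z \<le> 1"
  unfolding enc_def by (rule cantor_nonneg cantor_le_1)+

text \<open>This left inverse is what allows measures to be pushed to the line along
  \<open>enc\<close> and brought back along \<open>dec\<close>.\<close>

lemma dec_enc [simp]: "dec (enc z) = (z :: 'a::polish_space)"
proof -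
  have "dist (dec_approx (enc z) k) z < (1 / 2) ^ k" for k
  proof -
    have "\<exists>j. dense_seq j \<in> ball z ((1 / 2) ^ k)" by (rule dense_seq) (auto simp: not_le)
    then have "\<exists>j. dist (dense_seq j) z < (1 / 2) ^ k" by (simp add: dist_commute)
    then have "dist (dense_seq (LEAST j. dist (dense_seq j) z < (1 / 2) ^ k)) z < (1 / 2) ^ k"
      by (rule LeastI_ex)
    then show ?thesis by (simp add: dec_approx_def enc_def)
  qed
  then have "\<forall>k. norm (dist (dec_approx (enc z) k) z) \<le> (1 / 2) ^ k" by (simp add: less_imp_le)
  then have "(\<lambda>k. dist (dec_approx (enc z) k) z) \<longlonglongrightarrow> 0"
    by (rule Lim_null_comparison[OF always_eventually]) (rule LIMSEQ_power_zero, simp)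
  then have *: "dec_approx (enc z) \<longlonglongrightarrow> z" by (rule tendsto_dist_iff[THEN iffD2])
  then show ?thesis by (simp add: dec_def LIMSEQ_imp_Cauchy limI)
qed

lemma measurable_enc [measurable]: "enc \<in> borel_measurable borel"
  unfolding enc_def[abs_def] by (rule measurable_cantor) (auto split: prod.split)

lemma measurable_dec [measurable]: "(dec :: real \<Rightarrow> 'a::polish_space) \<in> borel_measurable borel"
proof (rule borel_measurable_LIMSEQ_metric)
  have *: "(\<lambda>r. dec_approx r k :: 'a) \<in> borel_measurable borel" for k
    unfolding dec_approx_def by (rule measurable_compose[OF measurable_Least]) auto
  have [measurable]: "Measurable.pred borel (\<lambda>r. Cauchy (dec_approx r :: nat \<Rightarrow> 'a))"
    using sets_Collect_Cauchy[OF *] by (simp add: pred_def)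
  note *[measurable]
  show "(\<lambda>r. if Cauchy (dec_approx r :: nat \<Rightarrow> 'a) then dec_approx r k else dense_seq 0 :: 'a)
      \<in> borel_measurable borel" for k by measurable
  show "(\<lambda>k. if Cauchy (dec_approx r :: nat \<Rightarrow> 'a) then dec_approx r k else dense_seq 0 :: 'a)
      \<longlonglongrightarrow> dec r" for r
    by (auto simp: dec_def Cauchy_convergent_iff convergent_LIMSEQ_iff)
qed

subsection \<open>Quantile functions\<close>

text \<open>The generalized inverse of a distribution function on [0, 1] known at rationals.
  Inserting 1 and asking for nonnegative \<open>q\<close> keeps the values in [0, 1] for arbitrary
  \<open>c\<close>.\<close>

definition quant :: "(rat \<Rightarrow> real) \<Rightarrow> real \<Rightarrow> real" where
  "quant c s = Inf (insert 1 {real_of_rat q | q. 0 \<le> q \<and> s \<le> c q})"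

definition unif :: "real measure" where
  "unif = uniform_measure lborel {0..1}"

text \<open>Inverse transform sampling. The result is a probability measure for every
  \<open>c\<close>, so no exceptional set has to be cut out later.\<close>

definition qker :: "(rat \<Rightarrow> real) \<Rightarrow> real measure" where
  "qker c = distr unif borel (quant c)"

text \<open>The strict inequality eliminates the infimum and leaves a countable condition on
  \<open>c\<close> and \<open>s\<close>, from which joint measurability can be read off.\<close>

lemma quant_less:
  "quant c s < a \<longleftrightarrow> 1 < a \<or> (\<exists>q\<ge>0. real_of_rat q < a \<and> s \<le> c q)"
  unfolding quant_def
  by (subst cInf_less_iff) (auto intro!: bdd_belowI[of _ 0])

lemma measurable_quant [measurable]:
  "(\<lambda>(c, s). quant c s) \<in> borel_measurable (borel \<Otimes>\<^sub>M borel)"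
proof (rule borel_measurableI_less)
  fix a
  have [measurable]: "(\<lambda>c :: rat \<Rightarrow> real. c q) \<in> borel_measurable borel" for q
    by (rule measurable_product_coordinates)
  have "Measurable.pred (borel \<Otimes>\<^sub>M borel)
      (\<lambda>x :: (rat \<Rightarrow> real) \<times> real. 1 < a \<or> (\<exists>q. 0 \<le> q \<and> real_of_rat q < a \<and> snd x \<le> fst x q))"
    by measurable
  then show "{x \<in> space (borel \<Otimes>\<^sub>M borel). (case x of (c, s) \<Rightarrow> quant c s) < a} \<in> sets (borel \<Otimes>\<^sub>M borel)"
    by (simp add: pred_def quant_less split_beta)
qed

lemma prob_space_unif: "prob_space unif"
  unfolding unif_def by (rule prob_space_uniform_measure) auto

lemma sets_unif [measurable_cong]: "sets unif = sets borel"
  by (simp add: unif_def)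

lemma unif_in_prob_algebra: "unif \<in> space (prob_algebra borel)"
  by (simp add: space_prob_algebra prob_space_unif sets_unif)

lemma measurable_qker [measurable]: "qker \<in> borel \<rightarrow>\<^sub>M prob_algebra borel"
  unfolding qker_def[abs_def]
  by (rule measurable_distr_prob_space2[where M = borel])
     (auto intro: measurable_const unif_in_prob_algebra)

lemma emeasure_unif_atMost:
  assumes "0 \<le> u" "u \<le> 1"
  shows "emeasure unif {..u} = ennreal u"
proof -
  have "{0..1} \<inter> {..u} = {0..u}" using assms by auto
  then show ?thesis using assms by (simp add: unif_def divide_ennreal_def)
qed

lemma measurable_quant_section: "quant c \<in> borel_measurable unif"
  using measurable_Pair2[OF measurable_quant, of c] by (simp add: measurable_cong_sets[OF sets_unif])

lemma emeasure_qker_lessThan_gt_1: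
  assumes "1 < a"
  shows "emeasure (qker c) {..<a} = 1"
proof -
  interpret prob_space unif by (rule prob_space_unif)
  have "quant c -` {..<a} \<inter> space unif = space unif" using assms by (auto simp: quant_less)
  then show ?thesis
    by (simp add: qker_def emeasure_distr measurable_quant_section emeasure_space_1)
qed

lemma emeasure_qker_lessThan_nonpos:
  assumes "a \<le> 0"
  shows "emeasure (qker c) {..<a} = 0"
proof -
  have "quant c -` {..<a} \<inter> space unif = {}"
    using assms by (auto simp: quant_less) (meson le_less_trans not_le zero_le_of_rat_iff)
  then show ?thesis by (simp add: qker_def emeasure_distr measurable_quant_section)
qed

text \<open>A monotone sequence cofinal in the rationals below \<open>a\<close> turns suprema over
  those rationals into monotone limits.\<close>

lemma rat_approx_below:
  assumes "0 < (a::real)"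
  obtains r :: "nat \<Rightarrow> rat" where "incseq r" "\<And>n. 0 \<le> r n" "\<And>n. real_of_rat (r n) < a"
    "\<And>q. real_of_rat q < a \<Longrightarrow> \<exists>n. q \<le> r n"
proof -
  \<comment> \<open>The largest multiple of 2^-n strictly below \<open>a\<close>. Subtracting 1 from
    the ceiling keeps the inequality strict when \<open>a * 2 ^ n\<close> is an integer, and the
    result is nonnegative because the ceiling is at least 1.\<close>
  define r where "r n = (of_int (\<lceil>a * 2 ^ n\<rceil> - 1) / 2 ^ n :: rat)" for n
  have r: "real_of_rat (r n) = (of_int \<lceil>a * 2 ^ n\<rceil> - 1) / 2 ^ n" for n
    by (simp add: r_def of_rat_divide of_rat_diff of_rat_power)
  show thesis
  proof (rule that[of r])
    show "incseq r"
    proof (rule incseq_SucI)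
      fix n
      have "2 * (\<lceil>a * 2 ^ n\<rceil> - 1) < \<lceil>a * 2 ^ Suc n\<rceil>" by (simp; linarith)
      then have "(of_int (2 * (\<lceil>a * 2 ^ n\<rceil> - 1)) :: rat) \<le> of_int (\<lceil>a * 2 ^ Suc n\<rceil> - 1)"
        by (subst of_int_le_iff) simp
      then have "(of_int (2 * (\<lceil>a * 2 ^ n\<rceil> - 1)) / 2 ^ Suc n :: rat) \<le> r (Suc n)"
        unfolding r_def by (rule divide_right_mono) simp
      moreover have "(of_int (2 * k) / 2 ^ Suc n :: rat) = of_int k / 2 ^ n" for k by simp
      ultimately show "r n \<le> r (Suc n)" unfolding r_def by metis
    qed
    show "0 \<le> r n" for n using assms by (simp add: r_def zero_less_mult_iff)
    show lt: "real_of_rat (r n) < a" for n unfolding r by (simp add: field_simps; linarith)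
    fix q assume q: "real_of_rat q < a"
    then obtain n where n: "(1 / 2) ^ n < a - real_of_rat q"
      using real_arch_pow_inv[of "a - real_of_rat q" "1 / 2"] by auto
    have "a * 2 ^ n - 1 \<le> of_int \<lceil>a * 2 ^ n\<rceil> - 1" by simp
    then have "a - (1 / 2) ^ n \<le> real_of_rat (r n)"
      unfolding r by (simp add: field_simps power_one_over)
    then have "real_of_rat q < real_of_rat (r n)" using n by simp
    then show "\<exists>n. q \<le> r n" by (auto simp: of_rat_less intro: less_imp_le)
  qed
qed

lemma less_iff_rat_approx:
  assumes "\<And>n. real_of_rat (r n) < a" "\<And>q. real_of_rat q < a \<Longrightarrow> \<exists>n. q \<le> r n"
  shows "z < a \<longleftrightarrow> (\<exists>n. z \<le> real_of_rat (r n))"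
proof
  assume "z < a"
  then obtain q where "z < real_of_rat q" "real_of_rat q < a" using of_rat_dense[of z a] by auto
  moreover from this(2) obtain n where "q \<le> r n" using assms(2) by blast
  ultimately have "z \<le> real_of_rat (r n)" by (metis less_imp_le less_le_trans of_rat_less_eq)
  then show "\<exists>n. z \<le> real_of_rat (r n)" by blast
qed (use assms(1) le_less_trans in blast)

text \<open>The mass of an open half-line depends on \<open>c\<close> only at rationals strictly
  below \<open>a\<close>. Hence half-lines of this form serve as generators: the \<open>c\<close>
  obtained later from limits superior is monotone but may fail to be right-continuous.\<close>

lemma emeasure_qker_lessThan:
  assumes "mono c" "\<And>q. 0 \<le> c q" "\<And>q. c q \<le> 1" and a: "a \<le> 1"
    and r: "incseq r" "\<And>n. 0 \<le> r n" "\<And>n. real_of_rat (r n) < a"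
      "\<And>q. real_of_rat q < a \<Longrightarrow> \<exists>n. q \<le> r n"
  shows "emeasure (qker c) {..<a} = (SUP n. ennreal (c (r n)))"
proof -
  have "quant c -` {..<a} \<inter> space unif = (\<Union>n. {..c (r n)})"
  proof (intro equalityI subsetI)
    fix s assume "s \<in> quant c -` {..<a} \<inter> space unif"
    then obtain q where q: "real_of_rat q < a" "s \<le> c q" using a by (auto simp: quant_less)
    then obtain n where "q \<le> r n" using r(4) by blast
    then show "s \<in> (\<Union>n. {..c (r n)})" using q(2) monoD[OF assms(1)] by (meson UN_I UNIV_I atMost_iff order_trans)
  next
    fix s assume "s \<in> (\<Union>n. {..c (r n)})"
    then show "s \<in> quant c -` {..<a} \<inter> space unif"
      using r(2,3) by (auto simp: quant_less unif_def)
  qed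
  then have "emeasure (qker c) {..<a} = emeasure unif (\<Union>n. {..c (r n)})"
    by (simp add: qker_def emeasure_distr measurable_quant_section)
  also have "\<dots> = (SUP n. emeasure unif {..c (r n)})"
    by (rule SUP_emeasure_incseq[symmetric])
       (use r(1) monoD[OF assms(1)] in \<open>auto simp: sets_unif incseq_def intro: order_trans\<close>)
  also have "\<dots> = (SUP n. ennreal (c (r n)))"
    by (simp add: emeasure_unif_atMost assms)
  finally show ?thesis .
qed

lemma prob_eqI_lessThan:
  fixes p p' :: "real measure"
  assumes "prob_space p" "prob_space p'" "sets p = sets borel" "sets p' = sets borel"
    and eq: "\<And>a. emeasure p {..<a} = emeasure p' {..<a}"
  shows "p = p'"
proof (rule measure_eqI_generator_eq)
  have "{..<a} \<inter> {..<b} = {..<min a b}" for a b :: real by auto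
  then show "Int_stable (range lessThan :: real set set)"
    by (auto simp: Int_stable_def)
  show "sets p = sigma_sets UNIV (range lessThan)" "sets p' = sigma_sets UNIV (range lessThan)"
    using assms(3,4) by (simp_all add: borel_Iio)
  show "(\<Union>i. {..<real i}) = UNIV" using reals_Archimedean2 by auto
  show "emeasure p {..<real i} \<noteq> \<infinity>" for i
    using assms(1) by (simp add: finite_measure.emeasure_eq_measure prob_space_def)
qed (use eq in auto)

subsection \<open>Codes of probability measures\<close>

text \<open>A law is determined by the distribution function of its image under \<open>enc\<close>
  at rationals, a point of a countable product of lines. Coding that point by a real makes measures
  accessible to selection in Polish spaces.\<close>

definition mcode :: "'a::polish_space measure \<Rightarrow> real" where
  "mcode p = enc (\<lambda>q :: rat. measure p {x. enc x \<le> real_of_rat q})"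

definition mdec :: "real \<Rightarrow> 'a::polish_space measure" where
  "mdec r = distr (qker (dec r)) borel dec"

lemma measurable_mdec [measurable]: "mdec \<in> borel \<rightarrow>\<^sub>M prob_algebra borel"
  unfolding mdec_def[abs_def]
  by (rule measurable_compose[OF measurable_compose[OF measurable_dec measurable_qker]
        measurable_distr_prob_space]) simp

lemma measurable_mcode [measurable]: "mcode \<in> prob_algebra borel \<rightarrow>\<^sub>M borel"
proof -
  have "(\<lambda>p :: 'a measure. \<lambda>q :: rat. measure p {x. enc x \<le> real_of_rat q}) \<in> prob_algebra borel \<rightarrow>\<^sub>M borel"
    by (intro measurable_coordinatewise_then_product measurable_measure_prob_algebra) simp
  then show ?thesis unfolding mcode_def[abs_def] by measurable
qed

text \<open>\<open>qker\<close> rebuilds the image law under \<open>enc\<close> from its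
  distribution function, and \<open>dec\<close> undoes \<open>enc\<close>.\<close>

lemma mdec_mcode:
  assumes p: "p \<in> space (prob_algebra borel)"
  shows "mdec (mcode p) = (p :: 'a::polish_space measure)"
proof -
  interpret prob_space p using p by (simp add: space_prob_algebra)
  have sets_p [measurable_cong]: "sets p = sets borel" using p by (simp add: space_prob_algebra)
  have sp: "space p = UNIV" using sets_eq_imp_space_eq[OF sets_p] by simp
  let ?c = "\<lambda>q :: rat. measure p {x. enc x \<le> real_of_rat q}"
  have "qker ?c = distr p borel enc"
  proof (rule prob_eqI_lessThan)
    have "qker ?c \<in> space (prob_algebra borel)" using measurable_space[OF measurable_qker] by simp
    then show "prob_space (qker ?c)" "sets (qker ?c) = sets borel" by (auto simp: space_prob_algebra)
    show "prob_space (distr p borel enc)" by (rule prob_space_distr) simp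
    fix a :: real
    have enc: "emeasure (distr p borel enc) {..<a} = emeasure p {x. enc x < a}"
      by (simp add: emeasure_distr vimage_def sp)
    consider "1 < a" | "a \<le> 0" | "0 < a" "a \<le> 1" by linarith
    then show "emeasure (qker ?c) {..<a} = emeasure (distr p borel enc) {..<a}"
    proof cases
      case 1
      then have "{x :: 'a. enc x < a} = space p" using enc_le_1 le_less_trans by (auto simp: sp)
      then show ?thesis using 1 enc by (simp add: emeasure_qker_lessThan_gt_1 emeasure_space_1)
    next
      case 2
      then have "{x :: 'a. enc x < a} = {}" using enc_nonneg by (auto simp: not_less intro: order_trans)
      then show ?thesis using 2 enc by (simp add: emeasure_qker_lessThan_nonpos)
    next
      case 3
      obtain r where r: "incseq r" "\<And>n. 0 \<le> r n" "\<And>n. real_of_rat (r n) < a"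
        "\<And>q. real_of_rat q < a \<Longrightarrow> \<exists>n. q \<le> r n" using rat_approx_below[OF 3(1)] by blast
      have U: "{x :: 'a. enc x < a} = (\<Union>n. {x. enc x \<le> real_of_rat (r n)})"
        using less_iff_rat_approx[OF r(3,4)] by auto
      have "emeasure (qker ?c) {..<a} = (SUP n. ennreal (?c (r n)))"
        by (rule emeasure_qker_lessThan[OF _ _ _ 3(2) r])
           (auto intro!: monoI finite_measure_mono intro: order_trans simp: of_rat_less_eq)
      also have "\<dots> = (SUP n. emeasure p {x. enc x \<le> real_of_rat (r n)})"
        by (simp add: emeasure_eq_measure)
      also have "\<dots> = emeasure p {x. enc x < a}"
        unfolding U
        by (rule SUP_emeasure_incseq)
           (use r(1) in \<open>auto simp: sets_p incseq_def intro: order_trans simp flip: of_rat_less_eq[where 'a = real]\<close>)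
      finally show ?thesis by (simp add: enc)
    qed
  qed simp
  then have "mdec (mcode p) = distr (distr p borel enc) borel dec"
    by (simp add: mdec_def mcode_def)
  also have "\<dots> = distr p borel (\<lambda>x. x)" by (subst distr_distr) (auto simp: o_def)
  also have "\<dots> = p" by (rule distr_id2) (simp add: sets_p)
  finally show ?thesis .
qed

lemma univ_measurable_compose_measurable:
  assumes "f \<in> univ_measurable M N" "g \<in> N \<rightarrow>\<^sub>M K"
  shows "(\<lambda>x. g (f x)) \<in> univ_measurable M K"
  using assms by (auto simp: univ_measurable_def intro: measurable_compose)

text \<open>Sequences of naturals map onto any Polish space by a Borel map: read zero or nonzero
  entries as digits of a code and decode. Selecting in the preimage of \<open>G\<close> reduces the
  claim to sequences.\<close>

theorem jankov_von_neumann_selection: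
  fixes G :: "('a::polish_space \<times> 'b::polish_space) set"
  assumes "G \<in> sets borel"
  obtains s where "s \<in> univ_measurable borel borel" "\<And>x y. (x, y) \<in> G \<Longrightarrow> (x, s x) \<in> G"
proof -
  let ?d = "\<lambda>f :: nat \<Rightarrow> nat. dec (cantor (\<lambda>n. 0 < f n)) :: 'b"
  have [measurable]: "?d \<in> borel_measurable borel"
  proof (rule measurable_compose[OF measurable_cantor measurable_dec])
    fix n
    have "(\<lambda>f :: nat \<Rightarrow> nat. f n) \<in> borel_measurable borel" by (rule measurable_product_coordinates)
    then show "Measurable.pred borel (\<lambda>f :: nat \<Rightarrow> nat. 0 < f n)" by measurable
  qed
  have d: "\<exists>f. ?d f = y" for y
  proof
    show "?d (\<lambda>n. of_bool (cantor_digit (enc y) n)) = y"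
      using dec_enc[of y] unfolding enc_def by simp
  qed
  let ?h = "\<lambda>p :: 'a \<times> (nat \<Rightarrow> nat). (fst p, ?d (snd p))"
  have "?h \<in> borel \<Otimes>\<^sub>M borel \<rightarrow>\<^sub>M borel \<Otimes>\<^sub>M borel" by measurable
  then have "?h \<in> borel_measurable borel" by (simp add: borel_prod)
  from measurable_sets[OF this assms] have "?h -` G \<in> sets borel" by simp
  then obtain s where s: "s \<in> univ_measurable borel borel"
    "\<And>z f. (z, f) \<in> ?h -` G \<Longrightarrow> (z, s z) \<in> ?h -` G" using borel_sequence_selection by blast
  show thesis
  proof (rule that)
    show "(\<lambda>x. ?d (s x)) \<in> univ_measurable borel borel"
      by (rule univ_measurable_compose_measurable[OF s(1)]) simp
    fix x y assume "(x, y) \<in> G"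
    moreover obtain f where "?d f = y" using d by blast
    ultimately have "(x, f) \<in> ?h -` G" by simp
    then show "(x, ?d (s x)) \<in> G" using s(2) by fastforce
  qed
qed

subsection \<open>Differentiation of measures along a countable base\<close>

definition base_seq :: "nat \<Rightarrow> 'a::second_countable_topology set" where
  "base_seq = (SOME U. topological_basis (range U))"

lemma topological_basis_base_seq: "topological_basis (range (base_seq :: nat \<Rightarrow> 'a::second_countable_topology set))"
proof -
  obtain B :: "'a set set" where B: "countable B" "topological_basis B"
    using ex_countable_basis by blast
  have "B \<noteq> {}" using topological_basisE[OF B(2) open_UNIV UNIV_I] by blast
  then have "topological_basis (range (from_nat_into B))" using B by simp
  then show ?thesis unfolding base_seq_def by (rule someI[of "\<lambda>U. topological_basis (range U)"])
qed

text \<open>The atom containing \<open>y\<close> of the finite partition generated by the first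
  \<open>n\<close> base sets. Two cells are nested or disjoint.\<close>

definition cell :: "nat \<Rightarrow> 'a::second_countable_topology \<Rightarrow> 'a set" where
  "cell n y = {z. \<forall>i<n. z \<in> base_seq i \<longleftrightarrow> y \<in> base_seq i}"

lemma cell_self: "y \<in> cell n y" by (simp add: cell_def)

lemma cell_eq: "z \<in> cell n y \<Longrightarrow> cell n z = cell n y" by (auto simp: cell_def)

lemma cell_antimono: "m \<le> n \<Longrightarrow> cell n y \<subseteq> cell m y" by (auto simp: cell_def)

lemma base_seq_borel [measurable]: "base_seq i \<in> sets borel"
  by (rule borel_open, rule topological_basis_open[OF topological_basis_base_seq]) simp

lemma cell_borel [measurable]: "cell n y \<in> sets borel"
proof -
  have "{z \<in> space borel. \<forall>i<n. z \<in> base_seq i \<longleftrightarrow> y \<in> base_seq i} \<in> sets borel" by measurable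
  then show ?thesis by (simp add: cell_def)
qed

lemma cell_subset_open:
  assumes "open V" "y \<in> V"
  obtains n where "cell n y \<subseteq> V"
proof -
  obtain i where i: "y \<in> base_seq i" "base_seq i \<subseteq> V"
    using topological_basisE[OF topological_basis_base_seq assms] by blast
  then have "cell (Suc i) y \<subseteq> V" by (auto simp: cell_def)
  then show thesis by (rule that)
qed

lemma countable_cells: "countable {cell n y | n (y :: 'a::second_countable_topology). True}"
proof -
  let ?g = "\<lambda>(n, S). {z. \<forall>i<n. z \<in> base_seq i \<longleftrightarrow> i \<in> S}"
  have "cell n y = ?g (n, {i\<in>{..<n}. y \<in> base_seq i})" for n and y :: 'a
    by (auto simp: cell_def)
  then have "cell n y \<in> ?g ` (UNIV \<times> {S. finite S})" for n and y :: 'a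
    by (rule image_eqI) simp
  then have "{cell n y | n (y :: 'a). True} \<subseteq> ?g ` (UNIV \<times> {S. finite S})" by auto
  moreover have "countable (?g ` (UNIV \<times> {S. finite S}))"
    by (intro countable_image countable_SIGMA countable_Collect_finite) simp
  ultimately show ?thesis by (rule countable_subset)
qed

text \<open>A covering argument in the style of Vitali. Inside an open \<open>V\<close> containing
  \<open>B\<close>, each point takes its first good cell; these cells are disjoint and countably
  many, so the inequality adds up, and outer regularity shrinks \<open>V\<close> to
  \<open>B\<close>.\<close>

lemma cell_comparison:
  fixes M N :: "'a::polish_space measure"
  assumes M: "finite_measure M" "sets M = sets borel" and N: "finite_measure N" "sets N = sets borel"
    and B: "B \<in> sets borel"
    and le: "\<And>y m. y \<in> B \<Longrightarrow> \<exists>n\<ge>m. emeasure M (cell n y) \<le> emeasure N (cell n y)"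
  shows "emeasure M B \<le> emeasure N B"
proof -
  have "emeasure M B \<le> emeasure N V" if V: "B \<subseteq> V" "open V" for V
  proof -
    let ?P = "\<lambda>y n. cell n y \<subseteq> V \<and> emeasure M (cell n y) \<le> emeasure N (cell n y)"
    define k where "k y = (LEAST n. ?P y n)" for y
    have k: "?P y (k y)" if "y \<in> B" for y
    proof -
      obtain m where "cell m y \<subseteq> V" using cell_subset_open V \<open>y \<in> B\<close> by blast
      moreover obtain n where "n \<ge> m" "emeasure M (cell n y) \<le> emeasure N (cell n y)"
        using le[OF \<open>y \<in> B\<close>] by blast
      ultimately have "?P y n" using cell_antimono by blast
      then show ?thesis unfolding k_def by (rule LeastI)
    qed
    let ?D = "(\<lambda>y. cell (k y) y) ` B"
    have D_sets: "D \<in> sets borel" if "D \<in> ?D" for D using that by auto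
    have "?D \<subseteq> {cell n y | n y. True}" by blast
    then have cD: "countable ?D" using countable_cells countable_subset by blast
    \<comment> \<open>Whether level \<open>n\<close> is good depends on the cell only. So a point in
      the first good cell of \<open>y\<close> has a first good level no larger than that of
      \<open>y\<close>, and overlapping first good cells coincide.\<close>
    have aux: "cell (k y) y = cell (k y') y'"
      if "y \<in> B" "y' \<in> B" "z \<in> cell (k y) y" "z \<in> cell (k y') y'" "k y \<le> k y'" for y y' z
    proof -
      have "y' \<in> cell (k y') z" using cell_eq[OF that(4)] cell_self by blast
      then have "y' \<in> cell (k y) y" using cell_antimono[OF that(5)] cell_eq[OF that(3)] by blast
      then have eq: "cell (k y) y' = cell (k y) y" by (rule cell_eq)
      then have "?P y' (k y)" using k[OF that(1)] by simp
      then have "k y' \<le> k y" unfolding k_def by (rule Least_le)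
      then show ?thesis using eq that(5) by simp
    qed
    have "disjoint_family_on (\<lambda>D. D) ?D"
      unfolding disjoint_family_on_def
    proof (intro ballI impI, rule ccontr)
      fix D D' assume D: "D \<in> ?D" "D' \<in> ?D" "D \<noteq> D'" "D \<inter> D' \<noteq> {}"
      then obtain y y' z where "y \<in> B" "y' \<in> B" "D = cell (k y) y" "D' = cell (k y') y'" "z \<in> D" "z \<in> D'"
        by auto
      then show False using aux[of y y' z] aux[of y' y z] D(3) by (cases "k y \<le> k y'") auto
    qed
    then have U: "emeasure M' (\<Union>?D) = (\<integral>\<^sup>+D. emeasure M' D \<partial>count_space ?D)"
      if "sets M' = sets borel" for M' :: "'a measure"
      using emeasure_UN_countable[of ?D "\<lambda>D. D" M'] cD D_sets that by auto
    have UD: "\<Union>?D \<in> sets borel" using cD D_sets by (intro sets.countable_Union) auto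
    have "emeasure M B \<le> emeasure M (\<Union>?D)"
      using UD M(2) cell_self by (intro emeasure_mono) auto
    also have "\<dots> \<le> emeasure N (\<Union>?D)"
      unfolding U[OF M(2)] U[OF N(2)] using k by (intro nn_integral_mono) auto
    also have "\<dots> \<le> emeasure N V"
      using k V N(2) by (intro emeasure_mono) auto
    finally show ?thesis .
  qed
  then have "emeasure M B \<le> (INF V\<in>{V. B \<subseteq> V \<and> open V}. emeasure N V)"
    by (intro INF_greatest) auto
  also have "\<dots> = emeasure N B"
    using outer_regular[OF N(2) _ B] finite_measure.emeasure_finite[OF N(1)] by simp
  finally show ?thesis .
qed

text \<open>The upper derivative of \<open>N\<close> with respect to \<open>M\<close>. It uses only
  the measures of countably many cells, which is why it depends measurably on the measures
  too.\<close>

definition mderiv :: "'a::second_countable_topology measure \<Rightarrow> 'a measure \<Rightarrow> 'a \<Rightarrow> ennreal" where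
  "mderiv N M y = limsup (\<lambda>n. ennreal (measure N (cell n y) / measure M (cell n y)))"

text \<open>If the limit superior exceeds \<open>a\<close>, the quotient exceeds \<open>a\<close> at
  arbitrarily large levels, as \<open>cell_comparison\<close> requires.\<close>

lemma emeasure_le_mderiv:
  fixes M N :: "'a::polish_space measure"
  assumes M: "finite_measure M" "sets M = sets borel" and N: "finite_measure N" "sets N = sets borel"
    and B: "B \<in> sets borel" and less: "\<And>y. y \<in> B \<Longrightarrow> ennreal a < mderiv N M y" and a: "0 \<le> a"
  shows "ennreal a * emeasure M B \<le> emeasure N B"
proof -
  interpret M: finite_measure M by fact
  interpret N: finite_measure N by fact
  have "emeasure (scale_measure (ennreal a) M) B \<le> emeasure N B"
  proof (rule cell_comparison[OF _ _ N B])
    show "finite_measure (scale_measure (ennreal a) M)"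
      by (rule finite_measureI) (simp add: ennreal_mult_eq_top_iff)
    fix y m assume "y \<in> B"
    have "\<exists>n\<ge>m. ennreal a < ennreal (measure N (cell n y) / measure M (cell n y))"
    proof (rule ccontr)
      assume "\<not> ?thesis"
      then have "mderiv N M y \<le> ennreal a"
        unfolding mderiv_def by (intro Limsup_bounded) (auto simp: eventually_sequentially not_less)
      then show False using less[OF \<open>y \<in> B\<close>] by simp
    qed
    then obtain n where n: "n \<ge> m" "a < measure N (cell n y) / measure M (cell n y)"
      using a by (auto simp: ennreal_less_iff)
    then have "a * measure M (cell n y) \<le> measure N (cell n y)"
      by (cases "measure M (cell n y) = 0")
         (auto simp: field_simps zero_less_measure_iff intro: less_imp_le)
    then have "emeasure (scale_measure (ennreal a) M) (cell n y) \<le> emeasure N (cell n y)"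
      using a by (simp add: M.emeasure_eq_measure N.emeasure_eq_measure flip: ennreal_mult)
    then show "\<exists>n\<ge>m. emeasure (scale_measure (ennreal a) M) (cell n y) \<le> emeasure N (cell n y)"
      using n(1) by blast
  qed (simp add: M)
  then show ?thesis by simp
qed

lemma emeasure_ge_mderiv:
  fixes M N :: "'a::polish_space measure"
  assumes M: "finite_measure M" "sets M = sets borel" and N: "finite_measure N" "sets N = sets borel"
    and le: "\<And>A. A \<in> sets borel \<Longrightarrow> emeasure N A \<le> emeasure M A"
    and B: "B \<in> sets borel" and less: "\<And>y. y \<in> B \<Longrightarrow> mderiv N M y < ennreal a" and a: "0 \<le> a"
  shows "emeasure N B \<le> ennreal a * emeasure M B"
proof -
  interpret M: finite_measure M by fact
  interpret N: finite_measure N by fact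
  have "emeasure N B \<le> emeasure (scale_measure (ennreal a) M) B"
  proof (rule cell_comparison[OF N _ _ B])
    show "finite_measure (scale_measure (ennreal a) M)"
      by (rule finite_measureI) (simp add: ennreal_mult_eq_top_iff)
    fix y m assume "y \<in> B"
    have "eventually (\<lambda>n. ennreal (measure N (cell n y) / measure M (cell n y)) < ennreal a) sequentially"
      using less[OF \<open>y \<in> B\<close>] unfolding mderiv_def by (rule Limsup_lessD)
    then obtain n where n: "n \<ge> m" "ennreal (measure N (cell n y) / measure M (cell n y)) < ennreal a"
      unfolding eventually_sequentially by (meson nle_le)
    then have *: "measure N (cell n y) / measure M (cell n y) < a"
      by (simp add: ennreal_less_iff)
    \<comment> \<open>On a cell of \<open>M\<close>-measure zero the quotient is 0 by convention and
      says nothing about \<open>N\<close>; domination makes \<open>N\<close> vanish there.\<close>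
    have "measure N (cell n y) \<le> measure M (cell n y)"
      using le[of "cell n y"] by (simp add: M.emeasure_eq_measure N.emeasure_eq_measure)
    then have "measure N (cell n y) \<le> a * measure M (cell n y)"
      using * by (cases "measure M (cell n y) = 0")
         (auto simp: field_simps zero_less_measure_iff measure_le_0_iff intro: less_imp_le)
    then have "emeasure N (cell n y) \<le> emeasure (scale_measure (ennreal a) M) (cell n y)"
      using a by (simp add: M.emeasure_eq_measure N.emeasure_eq_measure flip: ennreal_mult)
    then show "\<exists>n\<ge>m. emeasure N (cell n y) \<le> emeasure (scale_measure (ennreal a) M) (cell n y)"
      using n(1) by blast
  qed (simp add: M)
  then show ?thesis by simp
qed

lemma measurable_mderiv:
  fixes M N :: "'a::polish_space measure"
  assumes "finite_measure M" "sets M = sets borel" "finite_measure N" "sets N = sets borel"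
  shows "mderiv N M \<in> borel_measurable borel"
proof -
  have [measurable]: "(\<lambda>y. emeasure K (cell n y)) \<in> borel_measurable borel"
    if K: "finite_measure K" "sets K = sets borel" for K :: "'a measure" and n
  proof -
    interpret finite_measure K by fact
    have "{p \<in> space (borel \<Otimes>\<^sub>M borel). \<forall>i<n. snd p \<in> base_seq i \<longleftrightarrow> fst p \<in> base_seq i}
        \<in> sets (borel \<Otimes>\<^sub>M (borel :: 'a measure))" by measurable
    also have "{p \<in> space (borel \<Otimes>\<^sub>M borel). \<forall>i<n. snd p \<in> base_seq i \<longleftrightarrow> fst p \<in> base_seq i}
        = {p :: 'a \<times> 'a. snd p \<in> cell n (fst p)}" by (auto simp: cell_def space_pair_measure)
    also have "sets (borel \<Otimes>\<^sub>M (borel :: 'a measure)) = sets (borel \<Otimes>\<^sub>M K)"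
      by (rule sets_pair_measure_cong) (simp_all add: K(2))
    finally have "(\<lambda>y. emeasure K (Pair y -` {p. snd p \<in> cell n (fst p)})) \<in> borel_measurable borel"
      by (rule measurable_emeasure_Pair)
    then show ?thesis by (simp add: vimage_def)
  qed
  note this[OF assms(1,2), measurable] this[OF assms(3,4), measurable]
  show ?thesis unfolding mderiv_def[abs_def] measure_def by measurable
qed

text \<open>A Radon-Nikodym density \<open>g\<close> serves for comparison: on a set where
  \<open>g < a < a' < mderiv N M\<close>, or the other way round, the two one-sided estimates force
  \<open>M\<close>-measure zero. So \<open>mderiv N M\<close> is a version of
  \<open>g\<close>.\<close>

lemma nn_integral_mderiv:
  fixes M N :: "'a::polish_space measure"
  assumes M: "finite_measure M" "sets M = sets borel" and N: "finite_measure N" "sets N = sets borel"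
    and le: "\<And>A. A \<in> sets borel \<Longrightarrow> emeasure N A \<le> emeasure M A"
    and B: "B \<in> sets borel"
  shows "(\<integral>\<^sup>+y. mderiv N M y * indicator B y \<partial>M) = emeasure N B"
proof -
  interpret M: finite_measure M by fact
  interpret N: finite_measure N by fact
  have sp: "space M = UNIV" using M(2) sets_eq_imp_space_eq by fastforce
  have [measurable]: "mderiv N M \<in> borel_measurable M"
    using measurable_mderiv[OF M N] by (simp add: measurable_cong_sets[OF M(2)])
  have "absolutely_continuous M N"
    unfolding absolutely_continuous_def
  proof
    fix A assume "A \<in> null_sets M"
    then have "A \<in> sets borel" "emeasure M A = 0" using M(2) by auto
    then show "A \<in> null_sets N" using le[of A] N(2) by (auto intro!: null_setsI)
  qed
  then obtain g where g[measurable]: "g \<in> borel_measurable M" and dg: "density M g = N"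
    using M.Radon_Nikodym M(2) N(2) by metis
  have Ng: "emeasure N A = (\<integral>\<^sup>+y. g y * indicator A y \<partial>M)" if "A \<in> sets M" for A
    using that by (simp add: dg[symmetric] emeasure_density)
  have null: "emeasure M E = 0" if "ennreal a' * emeasure M E \<le> ennreal a * emeasure M E" "a < a'" "0 \<le> a" for a a' E
  proof -
    have "a' * measure M E \<le> a * measure M E"
      using that by (simp add: M.emeasure_eq_measure flip: ennreal_mult)
    then have "measure M E \<le> 0" using that(2) by (simp add: mult_le_cancel_right)
    then show ?thesis by (simp add: M.emeasure_eq_measure measure_le_0_iff)
  qed
  have 1: "AE y in M. \<not> (g y < ennreal a \<and> ennreal a' < mderiv N M y)" if a: "0 \<le> a" "a < a'" for a a'
  proof -
    let ?E = "{y. g y < ennreal a \<and> ennreal a' < mderiv N M y}"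
    have "{y \<in> space M. g y < ennreal a \<and> ennreal a' < mderiv N M y} \<in> sets M" by measurable
    then have E: "?E \<in> sets M" by (simp add: sp)
    have "ennreal a' * emeasure M ?E \<le> emeasure N ?E"
      using E a M(2) by (intro emeasure_le_mderiv[OF M N]) auto
    also have "\<dots> = (\<integral>\<^sup>+y. g y * indicator ?E y \<partial>M)" by (rule Ng[OF E])
    also have "\<dots> \<le> (\<integral>\<^sup>+y. ennreal a * indicator ?E y \<partial>M)"
      by (intro nn_integral_mono) (auto split: split_indicator)
    also have "\<dots> = ennreal a * emeasure M ?E" using E by (simp add: nn_integral_cmult_indicator)
    finally have "emeasure M ?E = 0" using null a by blast
    then show ?thesis using E by (intro AE_I[of _ _ ?E]) auto
  qed
  have 2: "AE y in M. \<not> (mderiv N M y < ennreal a \<and> ennreal a' < g y)" if a: "0 \<le> a" "a < a'" for a a'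
  proof -
    let ?E = "{y. mderiv N M y < ennreal a \<and> ennreal a' < g y}"
    have "{y \<in> space M. mderiv N M y < ennreal a \<and> ennreal a' < g y} \<in> sets M" by measurable
    then have E: "?E \<in> sets M" by (simp add: sp)
    have "ennreal a' * emeasure M ?E = (\<integral>\<^sup>+y. ennreal a' * indicator ?E y \<partial>M)"
      using E by (simp add: nn_integral_cmult_indicator)
    also have "\<dots> \<le> (\<integral>\<^sup>+y. g y * indicator ?E y \<partial>M)"
      by (intro nn_integral_mono) (auto split: split_indicator)
    also have "\<dots> = emeasure N ?E" by (rule Ng[OF E, symmetric])
    also have "\<dots> \<le> ennreal a * emeasure M ?E"
      using E a M(2) by (intro emeasure_ge_mderiv[OF M N le]) auto
    finally have "emeasure M ?E = 0" using null a by blast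
    then show ?thesis using E by (intro AE_I[of _ _ ?E]) auto
  qed
  \<comment> \<open>Two distinct values are separated by two rationals, so countably many null sets
    cover the points where the functions differ.\<close>
  have sep: "\<exists>p q :: rat. 0 \<le> real_of_rat p \<and> real_of_rat p < real_of_rat q \<and>
      u < ennreal (real_of_rat p) \<and> ennreal (real_of_rat q) < v" if uv: "u < v" for u v
  proof -
    obtain p :: rat where p: "u < ennreal (real_of_rat p)" "ennreal (real_of_rat p) < v"
      using ennreal_rat_dense[OF uv] by blast
    obtain q :: rat where q: "ennreal (real_of_rat p) < ennreal (real_of_rat q)" "ennreal (real_of_rat q) < v"
      using ennreal_rat_dense[OF p(2)] by blast
    have "0 \<le> real_of_rat p" using p(1) by (metis ennreal_neg not_less_zero nle_le)
    then show ?thesis using p q by (metis ennreal_less_iff)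
  qed
  have "AE y in M. \<forall>p q :: rat. 0 \<le> real_of_rat p \<longrightarrow> real_of_rat p < real_of_rat q \<longrightarrow>
      \<not> (g y < ennreal (real_of_rat p) \<and> ennreal (real_of_rat q) < mderiv N M y) \<and>
      \<not> (mderiv N M y < ennreal (real_of_rat p) \<and> ennreal (real_of_rat q) < g y)"
    unfolding AE_all_countable
  proof (intro allI)
    fix p q :: rat
    show "AE y in M. 0 \<le> real_of_rat p \<longrightarrow> real_of_rat p < real_of_rat q \<longrightarrow>
      \<not> (g y < ennreal (real_of_rat p) \<and> ennreal (real_of_rat q) < mderiv N M y) \<and>
      \<not> (mderiv N M y < ennreal (real_of_rat p) \<and> ennreal (real_of_rat q) < g y)"
    proof (cases "0 \<le> real_of_rat p \<and> real_of_rat p < real_of_rat q")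
      case True
      with 1[of "real_of_rat p" "real_of_rat q"] 2[of "real_of_rat p" "real_of_rat q"]
      show ?thesis by (auto elim: AE_mp)
    qed auto
  qed
  then have "AE y in M. mderiv N M y = g y"
  proof eventually_elim
    case (elim y)
    show ?case
    proof (rule ccontr)
      assume "mderiv N M y \<noteq> g y"
      then consider "mderiv N M y < g y" | "g y < mderiv N M y" by fastforce
      then show False using elim sep by cases blast+
    qed
  qed
  then have "(\<integral>\<^sup>+y. mderiv N M y * indicator B y \<partial>M) = (\<integral>\<^sup>+y. g y * indicator B y \<partial>M)"
    by (intro nn_integral_cong_AE) auto
  then show ?thesis using Ng B M(2) by simp
qed

subsection \<open>Measurable disintegration\<close>

definition slice :: "('a::polish_space \<times> 'b::polish_space) measure \<Rightarrow> rat \<Rightarrow> 'b measure" where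
  "slice w q = distr (density w (indicator ({x. enc x \<le> real_of_rat q} \<times> UNIV))) borel snd"

text \<open>The conditional probability of \<open>enc x \<le> q\<close> given \<open>y\<close>, in
  the version defined by differentiation.\<close>

definition disint_cdf :: "('a::polish_space \<times> 'b::polish_space) measure \<Rightarrow> 'b \<Rightarrow> rat \<Rightarrow> real" where
  "disint_cdf w y q = enn2real (mderiv (slice w q) (distr w borel snd) y)"

definition disint :: "('a::polish_space \<times> 'b::polish_space) measure \<Rightarrow> 'b \<Rightarrow> 'a measure" where
  "disint w y = distr (qker (disint_cdf w y)) borel dec"

context
  fixes w :: "('a::polish_space \<times> 'b::polish_space) measure"
  assumes w: "w \<in> space (prob_algebra borel)"
begin

interpretation prob_space w using w by (simp add: space_prob_algebra)

lemma sets_joint [measurable_cong]: "sets w = sets borel"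
  using w by (simp add: space_prob_algebra)

lemma space_joint: "space w = UNIV"
  using sets_eq_imp_space_eq[OF sets_joint] by simp

lemma snd_measurable_joint: "snd \<in> borel_measurable w"
  by (simp add: measurable_cong_sets[OF sets_joint refl] flip: borel_prod)

lemma Times_sets_joint: "A \<in> sets borel \<Longrightarrow> B \<in> sets borel \<Longrightarrow> A \<times> B \<in> sets w"
  by (simp add: sets_joint flip: borel_prod)

lemma emeasure_slice:
  assumes "B \<in> sets borel"
  shows "emeasure (slice w q) B = emeasure w ({x. enc x \<le> real_of_rat q} \<times> B)"
proof -
  let ?A = "{x :: 'a. enc x \<le> real_of_rat q}"
  have A: "?A \<times> UNIV \<in> sets w" "UNIV \<times> B \<in> sets w" using assms by (auto intro!: Times_sets_joint)
  have "emeasure (slice w q) B = emeasure (density w (indicator (?A \<times> UNIV))) (UNIV \<times> B)"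
    unfolding slice_def
    by (subst emeasure_distr) (use assms snd_measurable_joint in \<open>auto simp: space_joint intro!: arg_cong2[where f = emeasure]\<close>)
  also have "\<dots> = emeasure w ((?A \<times> UNIV) \<inter> (UNIV \<times> B))"
    using A by (subst emeasure_density) (auto simp flip: indicator_inter_arith)
  also have "(?A \<times> UNIV) \<inter> (UNIV \<times> B) = ?A \<times> B" by auto
  finally show ?thesis .
qed

lemma emeasure_distr_snd:
  assumes "B \<in> sets borel"
  shows "emeasure (distr w borel snd) B = emeasure w (UNIV \<times> B)"
  using assms snd_measurable_joint
  by (subst emeasure_distr) (auto simp: space_joint intro!: arg_cong2[where f = emeasure])

lemma slice_le:
  assumes "B \<in> sets borel"
  shows "emeasure (slice w q) B \<le> emeasure (distr w borel snd) B"
  unfolding emeasure_slice[OF assms] emeasure_distr_snd[OF assms]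
  using assms by (intro emeasure_mono Times_sets_joint) auto

lemma sets_slice: "sets (slice w q) = sets borel"
  by (simp add: slice_def)

lemma finite_distr_snd: "finite_measure (distr w borel snd)"
  using snd_measurable_joint by (rule finite_measure_distr)

lemma finite_slice: "finite_measure (slice w q)"
proof (rule finite_measureI)
  have "emeasure (slice w q) UNIV \<noteq> \<infinity>" using slice_le[of UNIV q]
      finite_measure.emeasure_finite[OF finite_distr_snd, of UNIV] by (auto simp: top_unique)
  then show "emeasure (slice w q) (space (slice w q)) \<noteq> \<infinity>" by (simp add: slice_def)
qed

lemma mderiv_slice:
  "mderiv (slice w q) (distr w borel snd) y = limsup (\<lambda>n.
     ennreal (measure w ({x. enc x \<le> real_of_rat q} \<times> cell n y) / measure w (UNIV \<times> cell n y)))"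
  unfolding mderiv_def measure_def by (simp add: emeasure_slice emeasure_distr_snd)

lemma mderiv_slice_le_1: "mderiv (slice w q) (distr w borel snd) y \<le> 1"
  unfolding mderiv_slice
proof (intro Limsup_bounded always_eventually allI)
  fix n
  have "measure w ({x. enc x \<le> real_of_rat q} \<times> cell n y) \<le> measure w (UNIV \<times> cell n y)"
    by (intro finite_measure_mono Times_sets_joint) auto
  then show "ennreal (measure w ({x. enc x \<le> real_of_rat q} \<times> cell n y) / measure w (UNIV \<times> cell n y)) \<le> 1"
    by (auto simp: divide_le_eq_1 zero_less_measure_iff)
qed

lemma ennreal_disint_cdf: "ennreal (disint_cdf w y q) = mderiv (slice w q) (distr w borel snd) y"
  unfolding disint_cdf_def
  using mderiv_slice_le_1[of q y] by (auto intro!: ennreal_enn2real simp: less_top[symmetric] top_unique)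

lemma disint_cdf_nonneg: "0 \<le> disint_cdf w y q"
  by (simp add: disint_cdf_def)

lemma disint_cdf_le_1: "disint_cdf w y q \<le> 1"
  using mderiv_slice_le_1[of q y] ennreal_disint_cdf[of y q] by (metis ennreal_le_1)

text \<open>True at every \<open>y\<close>, not just almost everywhere, since the quotients are
  monotone in \<open>q\<close> at each level. The bound by 1 is pointwise for the same
  reason.\<close>

lemma mono_disint_cdf: "mono (disint_cdf w y)"
proof (rule monoI)
  fix q q' :: rat assume "q \<le> q'"
  then have "real_of_rat q \<le> real_of_rat q'" by (simp add: of_rat_less_eq)
  then have "mderiv (slice w q) (distr w borel snd) y \<le> mderiv (slice w q') (distr w borel snd) y"
    unfolding mderiv_slice
    by (intro Limsup_mono always_eventually allI ennreal_leI divide_right_mono finite_measure_mono Times_sets_joint) auto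
  then show "disint_cdf w y q \<le> disint_cdf w y q'"
    unfolding ennreal_disint_cdf[symmetric] by (simp add: disint_cdf_nonneg)
qed

text \<open>Rationals increasing to \<open>a\<close> reduce the claim, by monotone convergence, to
  the derivative of each slice integrating back to the slice.\<close>

lemma emeasure_disint_rectangle:
  assumes B: "B \<in> sets borel"
  shows "(\<integral>\<^sup>+y. emeasure (qker (disint_cdf w y)) {..<a} * indicator B y \<partial>distr w borel snd)
       = emeasure w ({x. enc x < a} \<times> B)"
proof -
  have snd1: "emeasure w (UNIV \<times> B) = (\<integral>\<^sup>+y. 1 * indicator B y \<partial>distr w borel snd)"
    using B by (simp add: emeasure_distr_snd)
  consider "1 < a" | "a \<le> 0" | "0 < a" "a \<le> 1" by linarith
  then show ?thesis
  proof cases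
    case 1
    then have "{x :: 'a. enc x < a} = UNIV" using enc_le_1 le_less_trans by auto
    then show ?thesis using 1 snd1 by (simp add: emeasure_qker_lessThan_gt_1)
  next
    case 2
    then have "{x :: 'a. enc x < a} = {}" using enc_nonneg by (auto simp: not_less intro: order_trans)
    then show ?thesis using 2 by (simp add: emeasure_qker_lessThan_nonpos)
  next
    case 3
    obtain r where r: "incseq r" "\<And>n. 0 \<le> r n" "\<And>n. real_of_rat (r n) < a"
      "\<And>q. real_of_rat q < a \<Longrightarrow> \<exists>n. q \<le> r n" using rat_approx_below[OF 3(1)] by blast
    let ?f = "\<lambda>n y. ennreal (disint_cdf w y (r n)) * indicator B y"
    have meas: "?f n \<in> borel_measurable (distr w borel snd)" for n
      unfolding ennreal_disint_cdf
      using measurable_mderiv[OF finite_distr_snd _ finite_slice[of "r n"]] B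
      by (auto simp: sets_slice intro!: borel_measurable_times_ennreal borel_measurable_indicator)
    have "emeasure (qker (disint_cdf w y)) {..<a} * indicator B y = (SUP n. ?f n y)" for y
      using emeasure_qker_lessThan[OF mono_disint_cdf disint_cdf_nonneg disint_cdf_le_1 3(2) r]
      by (simp add: SUP_mult_right_ennreal)
    then have "(\<integral>\<^sup>+y. emeasure (qker (disint_cdf w y)) {..<a} * indicator B y \<partial>distr w borel snd)
        = (\<integral>\<^sup>+y. (SUP n. ?f n y) \<partial>distr w borel snd)" by simp
    also have "\<dots> = (SUP n. \<integral>\<^sup>+y. ?f n y \<partial>distr w borel snd)"
    proof (rule nn_integral_monotone_convergence_SUP[OF _ meas])
      show "incseq ?f"
        using r(1) monoD[OF mono_disint_cdf]
        by (auto simp: incseq_def le_fun_def intro!: mult_right_mono ennreal_leI)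
    qed
    also have "\<dots> = (SUP n. emeasure w ({x. enc x \<le> real_of_rat (r n)} \<times> B))"
      unfolding ennreal_disint_cdf
      using nn_integral_mderiv[OF finite_distr_snd _ finite_slice sets_slice slice_le B] B
      by (simp add: emeasure_slice)
    also have "\<dots> = emeasure w (\<Union>n. {x. enc x \<le> real_of_rat (r n)} \<times> B)"
    proof (rule SUP_emeasure_incseq)
      show "range (\<lambda>n. {x :: 'a. enc x \<le> real_of_rat (r n)} \<times> B) \<subseteq> sets w"
        using B by (auto intro!: Times_sets_joint)
      show "incseq (\<lambda>n. {x :: 'a. enc x \<le> real_of_rat (r n)} \<times> B)"
        using r(1) by (auto simp: incseq_def intro: order_trans simp flip: of_rat_less_eq[where 'a = real])
    qed
    also have "(\<Union>n. {x :: 'a. enc x \<le> real_of_rat (r n)} \<times> B) = {x. enc x < a} \<times> B"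
      using less_iff_rat_approx[OF r(3,4)] by auto
    finally show ?thesis .
  qed
qed

end

text \<open>The payoff of differentiating along cells: the value is a limit superior of quotients of
  \<open>w\<close>-measures of sets that vary measurably with \<open>y\<close>, so it is Borel
  jointly in \<open>w\<close> and \<open>y\<close>.\<close>

lemma measurable_disint_cdf:
  "(\<lambda>(w, y). disint_cdf w y) \<in>
     prob_algebra (borel :: ('a::polish_space \<times> 'b::polish_space) measure) \<Otimes>\<^sub>M borel \<rightarrow>\<^sub>M borel"
proof (rule measurable_coordinatewise_then_product)
  fix q
  let ?S = "prob_algebra (borel :: ('a \<times> 'b) measure) \<Otimes>\<^sub>M (borel :: 'b measure)"
  have m: "(\<lambda>p. measure (fst p) (A \<times> cell n (snd p))) \<in> borel_measurable ?S"
    if [measurable]: "A \<in> sets borel" for A :: "'a set" and n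
  proof (rule measure_measurable_prob_algebra2[where N = "borel \<Otimes>\<^sub>M borel"])
    have "{p \<in> space (?S \<Otimes>\<^sub>M (borel \<Otimes>\<^sub>M borel)). fst (snd p) \<in> A \<and>
        (\<forall>i<n. snd (snd p) \<in> base_seq i \<longleftrightarrow> snd (fst p) \<in> base_seq i)} \<in> sets (?S \<Otimes>\<^sub>M (borel \<Otimes>\<^sub>M borel))"
      by measurable
    also have "{p \<in> space (?S \<Otimes>\<^sub>M (borel \<Otimes>\<^sub>M borel)). fst (snd p) \<in> A \<and>
        (\<forall>i<n. snd (snd p) \<in> base_seq i \<longleftrightarrow> snd (fst p) \<in> base_seq i)}
        = (SIGMA p:space ?S. A \<times> cell n (snd p))"
      by (auto simp: space_pair_measure cell_def)
    finally show "(SIGMA p:space ?S. A \<times> cell n (snd p)) \<in> sets (?S \<Otimes>\<^sub>M (borel \<Otimes>\<^sub>M borel))" .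
    show "fst \<in> ?S \<rightarrow>\<^sub>M prob_algebra (borel \<Otimes>\<^sub>M borel)" by (simp add: borel_prod)
  qed
  note m[measurable]
  have "(\<lambda>p. enn2real (limsup (\<lambda>n. ennreal (measure (fst p) ({x. enc x \<le> real_of_rat q} \<times> cell n (snd p))
       / measure (fst p) (UNIV \<times> cell n (snd p)))))) \<in> borel_measurable ?S" by measurable
  then show "(\<lambda>p. (case p of (w, y) \<Rightarrow> disint_cdf w y) q) \<in> borel_measurable ?S"
    by (rule measurable_cong[THEN iffD2, rotated])
       (auto simp: space_pair_measure disint_cdf_def mderiv_slice)
qed

lemma measurable_disint [measurable]:
  "(\<lambda>(w, y). disint w y) \<in>
     prob_algebra (borel :: ('a::polish_space \<times> 'b::polish_space) measure) \<Otimes>\<^sub>M borel \<rightarrow>\<^sub>M prob_algebra borel"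
  using measurable_compose[OF measurable_compose[OF measurable_disint_cdf measurable_qker]
      measurable_distr_prob_space[OF measurable_dec]]
  unfolding disint_def[abs_def] by (simp add: split_beta')

lemma bind_in_prob_algebra:
  assumes "p \<in> space (prob_algebra N)" "k \<in> N \<rightarrow>\<^sub>M prob_algebra K"
  shows "bind p k \<in> space (prob_algebra K)"
  by (rule measurable_space[OF measurable_bind_prob_space[OF measurable_const[OF assms(1)] assms(2)],
        of undefined "count_space UNIV"]) simp

lemma joint_eqI_lessThan:
  fixes M N :: "(real \<times> 'b::second_countable_topology) measure"
  assumes "finite_measure M" "sets M = sets borel" "sets N = sets borel"
    and eq: "\<And>a B. B \<in> sets borel \<Longrightarrow> emeasure M ({..<a} \<times> B) = emeasure N ({..<a} \<times> B)"
  shows "M = N"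
proof -
  let ?G = "{{..<a} \<times> B | a B. B \<in> sets (borel :: 'b measure)} :: (real \<times> 'b) set set"
  let ?S = "sigma UNIV ?G"
  have S: "sets ?S = sigma_sets UNIV ?G" by simp
  have G: "X \<in> ?G \<Longrightarrow> X \<in> sets ?S" for X by (simp add: S sigma_sets.Basic)
  have "fst \<in> borel_measurable ?S"
  proof (rule borel_measurableI_less)
    fix a :: real
    have "{x \<in> space ?S. fst x < a} = {..<a} \<times> UNIV" by auto
    also have "\<dots> \<in> sets ?S" by (rule G) (auto intro!: exI[of _ UNIV])
    finally show "{x \<in> space ?S. fst x < a} \<in> sets ?S" .
  qed
  moreover have "snd \<in> ?S \<rightarrow>\<^sub>M borel"
  proof (rule measurableI)
    fix B :: "'b set" assume B: "B \<in> sets borel"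
    have "snd -` B \<inter> space ?S = (\<Union>n. {..<real n} \<times> B)"
      using reals_Archimedean2 by auto
    also have "\<dots> \<in> sets ?S" using B by (intro sets.countable_UN) (auto intro!: G)
    finally show "snd -` B \<inter> space ?S \<in> sets ?S" .
  qed auto
  ultimately have "(\<lambda>x. (fst x, snd x)) \<in> ?S \<rightarrow>\<^sub>M borel \<Otimes>\<^sub>M borel" by (rule measurable_Pair)
  then have id: "(\<lambda>x. x) \<in> ?S \<rightarrow>\<^sub>M borel" by (simp add: borel_prod)
  have "sets borel \<subseteq> sets ?S" using measurable_sets[OF id] by auto
  moreover have "sets ?S \<subseteq> sets borel"
  proof -
    have "?G \<subseteq> sets borel" unfolding borel_prod[symmetric] by auto
    from sets.sigma_sets_subset[OF this] show ?thesis unfolding S by simp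
  qed
  ultimately have gen: "sets borel = sigma_sets UNIV ?G" by (simp add: S)
  show ?thesis
  proof (rule measure_eqI_generator_eq[where A = "\<lambda>n. {..<real n} \<times> UNIV"])
    have "({..<a} \<times> B) \<inter> ({..<a'} \<times> B') = {..<min a a'} \<times> (B \<inter> B')" for a a' :: real and B B' :: "'b set"
      by auto
    then show "Int_stable ?G"
      unfolding Int_stable_def by (auto; blast)
    show "(\<Union>n. {..<real n} \<times> (UNIV :: 'b set)) = UNIV" using reals_Archimedean2 by auto
    show "range (\<lambda>n. {..<real n} \<times> UNIV) \<subseteq> ?G"
      by (rule image_subsetI, rule CollectI, intro exI conjI, rule refl, simp)
    show "emeasure M ({..<real n} \<times> UNIV) \<noteq> \<infinity>" for n
      using finite_measure.emeasure_finite[OF assms(1)] by simp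
  qed (use assms(2,3) gen eq in auto)
qed

text \<open>With the first coordinate coded by \<open>enc\<close>, gluing the marginal and the
  kernel gives a measure that agrees with the image of \<open>w\<close> on half-line rectangles,
  hence equals it. Decoding returns the integral over \<open>w\<close>.\<close>

theorem nn_integral_disint:
  fixes w :: "('a::polish_space \<times> 'b::polish_space) measure"
  assumes w: "w \<in> space (prob_algebra borel)" and g: "g \<in> borel_measurable borel"
  shows "(\<integral>\<^sup>+p. g p \<partial>w) = (\<integral>\<^sup>+y. (\<integral>\<^sup>+x. g (x, y) \<partial>disint w y) \<partial>distr w borel snd)"
proof -
  interpret prob_space w using w by (simp add: space_prob_algebra)
  note [measurable_cong] = sets_joint[OF w]
  let ?v = "distr w borel snd"
  let ?k = "\<lambda>y. distr (qker (disint_cdf w y)) (borel \<Otimes>\<^sub>M borel) (\<lambda>r. (r, y))"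
  have [measurable]: "disint_cdf w \<in> borel_measurable borel"
    using measurable_Pair2[OF measurable_disint_cdf w] by simp
  have qk: "(\<lambda>y. qker (disint_cdf w y)) \<in> borel \<rightarrow>\<^sub>M prob_algebra borel" by measurable
  have sq [measurable_cong]: "sets (qker c) = sets borel" for c by (simp add: qker_def)
  have kb: "?k \<in> borel \<rightarrow>\<^sub>M prob_algebra (borel \<Otimes>\<^sub>M borel)"
    using measurable_distr_prob_space2[OF qk, of "\<lambda>y r. (r, y)" "borel \<Otimes>\<^sub>M borel"] by simp
  then have k: "?k \<in> ?v \<rightarrow>\<^sub>M prob_algebra (borel \<Otimes>\<^sub>M borel)" by simp
  have v: "?v \<in> space (prob_algebra borel)"
    using measurable_space[OF measurable_distr_prob_space w] snd_measurable_joint[OF w]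
    by (auto simp: space_prob_algebra intro!: prob_space_distr)
  define J where "J = ?v \<bind> ?k"
  have J: "J \<in> space (prob_algebra (borel \<Otimes>\<^sub>M borel))"
    unfolding J_def by (rule bind_in_prob_algebra[OF v kb])
  let ?w = "distr w (borel \<Otimes>\<^sub>M borel) (\<lambda>p. (enc (fst p), snd p))"
  have em: "(\<lambda>p. (enc (fst p), snd p)) \<in> w \<rightarrow>\<^sub>M borel \<Otimes>\<^sub>M borel"
    by (subst measurable_cong_sets[OF sets_joint[OF w] refl], subst borel_prod[symmetric]) measurable
  have "J = ?w"
  proof (rule joint_eqI_lessThan)
    show "finite_measure J" using J by (auto simp: space_prob_algebra prob_space_def)
    show "sets J = sets borel" using J by (simp add: space_prob_algebra borel_prod)
    show "sets ?w = sets borel" by (simp add: borel_prod)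
    fix a :: real and B :: "'b set" assume [measurable]: "B \<in> sets borel"
    have "emeasure J ({..<a} \<times> B) = (\<integral>\<^sup>+y. emeasure (?k y) ({..<a} \<times> B) \<partial>?v)"
      unfolding J_def by (rule emeasure_bind_prob_algebra[OF v kb]) simp
    also have "\<dots> = (\<integral>\<^sup>+y. emeasure (qker (disint_cdf w y)) {..<a} * indicator B y \<partial>?v)"
    proof (rule nn_integral_cong)
      fix y
      have "(\<lambda>r. (r, y)) -` ({..<a} \<times> B) \<inter> space (qker (disint_cdf w y)) = (if y \<in> B then {..<a} else {})"
        by (auto simp: qker_def)
      then show "emeasure (?k y) ({..<a} \<times> B) = emeasure (qker (disint_cdf w y)) {..<a} * indicator B y"
        by (subst emeasure_distr) (auto)
    qed
    also have "\<dots> = emeasure w ({x. enc x < a} \<times> B)"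
      by (rule emeasure_disint_rectangle[OF w]) simp
    also have "\<dots> = emeasure ?w ({..<a} \<times> B)"
      by (subst emeasure_distr[OF em])
         (auto simp: space_joint[OF w] intro!: arg_cong2[where f = emeasure])
    finally show "emeasure J ({..<a} \<times> B) = emeasure ?w ({..<a} \<times> B)" .
  qed
  have gm: "(\<lambda>p. g (dec (fst p), snd p)) \<in> borel_measurable (borel \<Otimes>\<^sub>M (borel :: 'b measure))"
    using g by (intro measurable_compose[OF _ g]) (subst borel_prod[symmetric], measurable)
  have "(\<integral>\<^sup>+p. g p \<partial>w) = (\<integral>\<^sup>+p. g (dec (fst p), snd p) \<partial>?w)"
    using gm by (subst nn_integral_distr[OF em]) simp_all
  also have "\<dots> = (\<integral>\<^sup>+p. g (dec (fst p), snd p) \<partial>J)" using \<open>J = ?w\<close> by simp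
  also have "\<dots> = (\<integral>\<^sup>+y. \<integral>\<^sup>+p. g (dec (fst p), snd p) \<partial>?k y \<partial>?v)"
    unfolding J_def by (rule nn_integral_bind[OF gm measurable_prob_algebraD[OF k]])
  also have "\<dots> = (\<integral>\<^sup>+y. \<integral>\<^sup>+x. g (x, y) \<partial>disint w y \<partial>?v)"
  proof (rule nn_integral_cong)
    fix y
    have g1: "(\<lambda>x. g (x, y)) \<in> borel_measurable borel"
      by (rule measurable_compose[OF _ g]) (subst borel_prod[symmetric], measurable)
    have "(\<integral>\<^sup>+p. g (dec (fst p), snd p) \<partial>?k y) = (\<integral>\<^sup>+r. g (dec r, y) \<partial>qker (disint_cdf w y))"
      using gm by (subst nn_integral_distr) auto
    also have "\<dots> = (\<integral>\<^sup>+x. g (x, y) \<partial>disint w y)"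
      unfolding disint_def using g1 by (subst nn_integral_distr) auto
    finally show "(\<integral>\<^sup>+p. g (dec (fst p), snd p) \<partial>?k y) = (\<integral>\<^sup>+x. g (x, y) \<partial>disint w y)" .
  qed
  finally show ?thesis .
qed

subsection \<open>Universally measurable maps\<close>

text \<open>Given a law \<open>P\<close>, \<open>g\<close> is tested against the completed image law
  of \<open>f\<close>, whose null sets pull back to null sets of the completion of
  \<open>P\<close>.\<close>

lemma univ_measurable_compose:
  assumes f: "f \<in> univ_measurable M N" and g: "g \<in> univ_measurable N K"
  shows "(\<lambda>x. g (f x)) \<in> univ_measurable M K"
  unfolding univ_measurable_def
proof (intro CollectI ballI)
  fix P assume P: "P \<in> space (prob_algebra M)"
  interpret P: prob_space "completion P"
    using P by (auto simp: space_prob_algebra intro: prob_space.prob_space_completion)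
  have fP: "f \<in> completion P \<rightarrow>\<^sub>M N" using f P by (auto simp: univ_measurable_def)
  let ?Q = "distr (completion P) N f"
  have "f \<in> completion P \<rightarrow>\<^sub>M ?Q" using fP by simp
  moreover have "distr (completion P) ?Q f = ?Q" by (rule distr_cong) simp_all
  then have "null_sets ?Q \<subseteq> null_sets (distr (completion P) ?Q f)" by simp
  ultimately have "f \<in> completion P \<rightarrow>\<^sub>M completion ?Q" by (rule completion.measurable_completion2)
  moreover have "g \<in> completion ?Q \<rightarrow>\<^sub>M K"
    using g P.prob_space_distr[OF fP] by (simp add: univ_measurable_def space_prob_algebra)
  ultimately show "(\<lambda>x. g (f x)) \<in> completion P \<rightarrow>\<^sub>M K" by (rule measurable_compose)
qed

lemma measurable_imp_univ_measurable:
  assumes "f \<in> M \<rightarrow>\<^sub>M N"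
  shows "f \<in> univ_measurable M N"
  unfolding univ_measurable_def
proof (intro CollectI ballI)
  fix P assume "P \<in> space (prob_algebra M)"
  then have "sets P = sets M" by (simp add: space_prob_algebra)
  then have "f \<in> P \<rightarrow>\<^sub>M N" using assms measurable_cong_sets by blast
  then show "f \<in> completion P \<rightarrow>\<^sub>M N" by (rule measurable_completion)
qed

lemma univ_measurable_Pair:
  assumes "f \<in> univ_measurable M N" "g \<in> univ_measurable M K"
  shows "(\<lambda>x. (f x, g x)) \<in> univ_measurable M (N \<Otimes>\<^sub>M K)"
  using assms by (auto simp: univ_measurable_def intro: measurable_Pair)

text \<open>Testing against the Dirac measure at \<open>x\<close> gives the value at that single
  point.\<close>

lemma univ_measurable_space:
  assumes "f \<in> univ_measurable M N" "x \<in> space M"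
  shows "f x \<in> space N"
proof -
  have P: "return M x \<in> space (prob_algebra M)"
    using assms(2) by (simp add: space_prob_algebra prob_space_return)
  then have "f \<in> completion (return M x) \<rightarrow>\<^sub>M N" using assms(1) by (auto simp: univ_measurable_def)
  then show ?thesis using assms(2) by (auto dest: measurable_space)
qed

subsection \<open>Lifting of mixed inputs\<close>

lemma measurable_trans:
  assumes "gmdp M"
  shows "(\<lambda>u. trans M x u) \<in> borel \<rightarrow>\<^sub>M prob_algebra borel"
  using measurable_Pair2[of "\<lambda>(x, u). trans M x u" borel borel "prob_algebra borel" x] assms
  by (simp add: gmdp_def borel_prod)

lemma mix_in_prob_algebra:
  assumes "gmdp M" "\<nu> \<in> space (prob_algebra borel)"
  shows "mix M x \<nu> \<in> space (prob_algebra borel)"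
  unfolding mix_def by (rule bind_in_prob_algebra[OF assms(2) measurable_trans[OF assms(1)]])

text \<open>The interface of a simulation relation carries no measurability; this selection replaces
  it by a universally measurable one.\<close>

lemma input_selection:
  fixes M :: "('x::polish_space, 'u::polish_space, 'y::metric_space) gmdp"
  assumes M: "gmdp M"
  obtains v :: "'x \<times> real \<Rightarrow> 'u measure" where
    "v \<in> univ_measurable borel (prob_algebra borel)"
    "\<And>x \<nu>. \<nu> \<in> space (prob_algebra borel) \<Longrightarrow> mix M x (v (x, mcode (mix M x \<nu>))) = mix M x \<nu>"
proof -
  let ?f = "\<lambda>p :: ('x \<times> real) \<times> real. mix M (fst (fst p)) (mdec (snd p))"
  have tr: "(\<lambda>p. trans M (fst p) (snd p)) \<in> borel \<Otimes>\<^sub>M borel \<rightarrow>\<^sub>M prob_algebra borel"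
    using M by (simp add: gmdp_def borel_prod split_beta')
  have "?f \<in> (borel \<Otimes>\<^sub>M borel) \<Otimes>\<^sub>M borel \<rightarrow>\<^sub>M prob_algebra borel"
    unfolding mix_def
  proof (rule measurable_bind_prob_space2[where N = borel])
    show "(\<lambda>p :: ('x \<times> real) \<times> real. mdec (snd p)) \<in> (borel \<Otimes>\<^sub>M borel) \<Otimes>\<^sub>M borel \<rightarrow>\<^sub>M prob_algebra (borel :: 'u measure)"
      by measurable
    show "(\<lambda>(p :: ('x \<times> real) \<times> real, u). trans M (fst (fst p)) u) \<in>
        ((borel \<Otimes>\<^sub>M borel) \<Otimes>\<^sub>M borel) \<Otimes>\<^sub>M borel \<rightarrow>\<^sub>M prob_algebra borel"
      unfolding split_beta'
      by (rule measurable_compose[OF _ tr, of "\<lambda>z. (fst (fst (fst z)), snd z)", simplified]) measurable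
  qed
  then have [measurable]: "(\<lambda>p. mcode (?f p)) \<in> borel_measurable ((borel \<Otimes>\<^sub>M borel) \<Otimes>\<^sub>M borel)"
    by measurable
  have [measurable]: "(\<lambda>p :: ('x \<times> real) \<times> real. mcode (mdec (snd (fst p)) :: 'x measure))
      \<in> borel_measurable ((borel \<Otimes>\<^sub>M borel) \<Otimes>\<^sub>M borel)" by measurable
  \<comment> \<open>Pairs (state and code of a target law, code of an input law) for which the input
    law produces the target. Comparing codes makes the relation Borel, and codes of probability
    measures are faithful.\<close>
  define G where "G = {p. mcode (?f p) = mcode (mdec (snd (fst p)) :: 'x measure)}"
  have "{p \<in> space ((borel \<Otimes>\<^sub>M borel) \<Otimes>\<^sub>M borel). mcode (?f p) = mcode (mdec (snd (fst p)) :: 'x measure)}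
      \<in> sets ((borel \<Otimes>\<^sub>M borel) \<Otimes>\<^sub>M borel)" by measurable
  then have "G \<in> sets borel" unfolding borel_prod G_def by simp
  then obtain s where s: "s \<in> univ_measurable borel borel" "\<And>x y. (x, y) \<in> G \<Longrightarrow> (x, s x) \<in> G"
    by (rule jankov_von_neumann_selection) blast
  have md: "mdec r \<in> space (prob_algebra borel)" for r
    using measurable_space[OF measurable_mdec, of r] by simp
  show thesis
  proof (rule that[of "\<lambda>p. mdec (s p)"])
    show "(\<lambda>p. mdec (s p) :: 'u measure) \<in> univ_measurable borel (prob_algebra borel)"
      by (rule univ_measurable_compose_measurable[OF s(1)]) simp
    fix x and \<nu> :: "'u measure" assume \<nu>: "\<nu> \<in> space (prob_algebra borel)"
    have p: "mix M x \<nu> \<in> space (prob_algebra borel)" by (rule mix_in_prob_algebra[OF M \<nu>])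
    let ?r = "mcode (mix M x \<nu>)"
    \<comment> \<open>The input law \<open>\<nu>\<close> itself shows that the section is nonempty,
      so the selected value solves the equation.\<close>
    have "((x, ?r), mcode \<nu>) \<in> G" by (simp add: G_def mdec_mcode[OF \<nu>] mdec_mcode[OF p])
    then have "((x, ?r), s (x, ?r)) \<in> G" by (rule s(2))
    then have "mcode (mix M x (mdec (s (x, ?r)))) = mcode (mix M x \<nu>)" by (simp add: G_def mdec_mcode[OF p])
    then show "mix M x (mdec (s (x, ?r))) = mix M x \<nu>"
      using mdec_mcode[OF p] mdec_mcode[OF mix_in_prob_algebra[OF M md]] by metis
  qed
qed

lemma bind_completion:
  assumes p: "p \<in> space (prob_algebra N)" and T: "T \<in> N \<rightarrow>\<^sub>M prob_algebra K"
  shows "bind (completion p) T = bind p T"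
proof -
  interpret prob_space p using p by (simp add: space_prob_algebra)
  have T1: "T \<in> p \<rightarrow>\<^sub>M subprob_algebra K"
    using p measurable_prob_algebraD[OF T] measurable_cong_sets[of p N]
    by (auto simp: space_prob_algebra)
  note T2 = measurable_completion[OF T1]
  have ne: "space (completion p) \<noteq> {}" "space p \<noteq> {}" using not_empty by auto
  show ?thesis
  proof (rule measure_eqI)
    show "sets (bind (completion p) T) = sets (bind p T)"
      using sets_bind_measurable[OF T1 ne(2)] sets_bind_measurable[OF T2 ne(1)] by simp
    fix A assume "A \<in> sets (bind (completion p) T)"
    then have "A \<in> sets K" using sets_bind_measurable[OF T2 ne(1)] by simp
    then show "emeasure (bind (completion p) T) A = emeasure (bind p T) A"
      by (simp add: emeasure_bind[OF ne(1) T2] emeasure_bind[OF ne(2) T1] nn_integral_completion)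
  qed
qed

text \<open>Mixtures of attainable next-state laws are attainable: the selected input law depends
  measurably on \<open>w\<close> after completion, so it can be averaged, and associativity of
  \<open>bind\<close> moves the average through \<open>mix\<close>.\<close>

lemma mix_bind:
  fixes M :: "('x::polish_space, 'u::polish_space, 'y::metric_space) gmdp"
    and p :: "'w::polish_space measure"
  assumes M: "gmdp M" and p: "p \<in> space (prob_algebra borel)"
    and T: "T \<in> borel \<rightarrow>\<^sub>M prob_algebra borel"
    and ex: "\<And>w. \<exists>\<nu>\<in>space (prob_algebra borel). mix M x \<nu> = T w"
  shows "\<exists>\<nu>\<in>space (prob_algebra borel). mix M x \<nu> = bind p T"
proof -
  obtain v :: "'x \<times> real \<Rightarrow> 'u measure" where
    v: "v \<in> univ_measurable borel (prob_algebra borel)"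
      "\<And>x \<nu>. \<nu> \<in> space (prob_algebra borel) \<Longrightarrow> mix M x (v (x, mcode (mix M x \<nu>))) = mix M x \<nu>"
    using input_selection[OF M] by blast
  define h where "h w = v (x, mcode (T w))" for w
  have hT: "mix M x (h w) = T w" for w
    using ex[of w] v(2)[of _ x] unfolding h_def by metis
  have "(\<lambda>w. (x, mcode (T w))) \<in> borel \<rightarrow>\<^sub>M borel \<Otimes>\<^sub>M borel" using T by measurable
  then have "(\<lambda>w. (x, mcode (T w))) \<in> univ_measurable borel borel"
    by (intro measurable_imp_univ_measurable) (simp add: borel_prod)
  then have "h \<in> univ_measurable borel (prob_algebra borel)"
    unfolding h_def[abs_def] by (rule univ_measurable_compose[OF _ v(1)])
  then have h: "h \<in> completion p \<rightarrow>\<^sub>M prob_algebra borel"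
    using p by (auto simp: univ_measurable_def)
  have cp: "completion p \<in> space (prob_algebra (completion p))"
    using p by (auto simp: space_prob_algebra intro: prob_space.prob_space_completion)
  have "bind (completion p) h \<in> space (prob_algebra borel)"
    by (rule bind_in_prob_algebra[OF cp h])
  moreover have "mix M x (bind (completion p) h) = bind (completion p) (\<lambda>w. mix M x (h w))"
    unfolding mix_def
    by (rule bind_assoc[OF measurable_prob_algebraD[OF h] measurable_prob_algebraD[OF measurable_trans[OF M]]])
  then have "mix M x (bind (completion p) h) = bind p T"
    by (simp add: hT bind_completion[OF p T])
  ultimately show ?thesis by blast
qed

subsection \<open>Accepting prefixes\<close>

lemma run_prefix:
  assumes "\<And>i. i < length ws \<Longrightarrow> w i = ws ! i"
  shows "run A w (length ws) = foldl (dtau A) (dq0 A) ws"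
  using assms
proof (induction ws rule: rev_induct)
  case (snoc a ws)
  have "w i = ws ! i" if "i < length ws" for i using snoc.prems[of i] that by (simp add: nth_append)
  moreover have "w (length ws) = a" using snoc.prems[of "length ws"] by simp
  ultimately show ?case using snoc.IH by simp
qed simp

text \<open>Acceptance is decided once the run meets \<open>dF A\<close>, so every continuation of
  the prefix is accepted.\<close>

lemma good_prefix_accepting:
  assumes "\<forall>w. accepts A w \<longleftrightarrow> sat w \<psi>" "foldl (dtau A) (dq0 A) ws \<in> dF A"
  shows "good_prefix \<psi> ws"
  unfolding good_prefix_def
  using assms run_prefix[of ws _ A] by (metis accepts_def)

lemma good_prefix_append: "good_prefix \<psi> ws \<Longrightarrow> good_prefix \<psi> (ws @ vs)"
  by (auto simp: good_prefix_def nth_append)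

text \<open>Settles the histories that have already accepted, where the robust value is replaced by
  the indicator of \<open>dF A\<close>.\<close>

lemma cyl_prob_eq_1:
  assumes "\<And>x m. prob_space (mix M x (cout C m))" "\<And>m x. prob_space (ctrans C m x)"
    and E: "\<And>ys zs. E ys \<Longrightarrow> E (ys @ zs)" and "E (ys @ [out M x])"
  shows "cyl_prob C M E n x m ys = 1"
  using assms(4)
proof (induction n arbitrary: x m ys)
  case (Suc n)
  have "cyl_prob C M E n x' m' (ys @ [out M x]) = 1" for x' m'
    by (rule Suc.IH) (use E[OF Suc.prems] in simp)
  moreover have "emeasure (mix M x (cout C m)) (space (mix M x (cout C m))) = 1"
    "\<And>x'. emeasure (ctrans C m x') (space (ctrans C m x')) = 1"
    using assms(1,2) by (auto intro: prob_space.emeasure_space_1)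
  ultimately show ?case by (simp add: nn_integral_completion)
qed simp

subsection \<open>The robust value iteration\<close>

text \<open>Besides being the integrand of \<open>robust_op\<close>, this expression at the initial
  states, with \<open>V_inf\<close> for \<open>V\<close>, is \<open>S_value\<close>.\<close>

definition robust_integrand ::
  "real \<Rightarrow> ('xh, 'uh, 'y::metric_space) gmdp \<Rightarrow> ('q::finite, 'ap) dfa \<Rightarrow> ('y \<Rightarrow> 'ap set)
     \<Rightarrow> ('xh \<Rightarrow> 'q \<Rightarrow> real) \<Rightarrow> 'q \<Rightarrow> 'xh \<Rightarrow> real" where
  "robust_integrand \<epsilon> Mh A L V q xh' = Min ((\<lambda>q'. max (indF A q') (V xh' q')) ` tbar \<epsilon> A L Mh q xh')"

lemma robust_op_eq:
  "robust_op \<epsilon> \<delta> Mh A L \<mu> V xh q = clamp01 (enn2real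
     (\<integral>\<^sup>+ xh'. ennreal (robust_integrand \<epsilon> Mh A L V q xh') \<partial>mix Mh xh (\<mu> (xh, q))) - \<delta>)"
  by (simp add: robust_op_def robust_integrand_def nn_integral_completion)

lemma robust_integrand_le:
  assumes "dist y (out Mh xh') \<le> \<epsilon>"
  shows "robust_integrand \<epsilon> Mh A L V q xh' \<le> max (indF A (dtau A q (L y))) (V xh' (dtau A q (L y)))"
  unfolding robust_integrand_def using assms by (intro Min_le) (auto simp: tbar_def)

lemma tbar_nonempty: "0 \<le> \<epsilon> \<Longrightarrow> tbar \<epsilon> A L Mh q xh' \<noteq> {}"
  by (auto simp: tbar_def intro: exI[of _ "out Mh xh'"])

lemma robust_integrand_mono:
  assumes "0 \<le> \<epsilon>" "\<And>q'. V xh' q' \<le> V' xh' q'"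
  shows "robust_integrand \<epsilon> Mh A L V q xh' \<le> robust_integrand \<epsilon> Mh A L V' q xh'"
  unfolding robust_integrand_def
proof (rule Min.boundedI)
  fix a assume "a \<in> (\<lambda>q'. max (indF A q') (V' xh' q')) ` tbar \<epsilon> A L Mh q xh'"
  then obtain q' where q': "q' \<in> tbar \<epsilon> A L Mh q xh'" "a = max (indF A q') (V' xh' q')" by auto
  then have "Min ((\<lambda>q'. max (indF A q') (V xh' q')) ` tbar \<epsilon> A L Mh q xh') \<le> max (indF A q') (V xh' q')"
    by (intro Min_le) auto
  also have "\<dots> \<le> a" unfolding q'(2) using assms(2) by (intro max.mono) auto
  finally show "Min ((\<lambda>q'. max (indF A q') (V xh' q')) ` tbar \<epsilon> A L Mh q xh') \<le> a" .
qed (use tbar_nonempty[OF assms(1), of A L Mh q xh'] in auto)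

lemma robust_integrand_le_1:
  assumes "0 \<le> \<epsilon>" "\<And>q'. V xh' q' \<le> 1"
  shows "robust_integrand \<epsilon> Mh A L V q xh' \<le> 1"
proof -
  have "robust_integrand \<epsilon> Mh A L V q xh' \<le>
      max (indF A (dtau A q (L (out Mh xh')))) (V xh' (dtau A q (L (out Mh xh'))))"
    using assms(1) by (intro robust_integrand_le) simp
  also have "\<dots> \<le> 1" using assms(2) by (auto simp: indF_def)
  finally show ?thesis .
qed

abbreviation robust_iter ::
  "real \<Rightarrow> real \<Rightarrow> ('xh, 'uh, 'y::metric_space) gmdp \<Rightarrow> ('q::finite, 'ap) dfa
     \<Rightarrow> ('y \<Rightarrow> 'ap set) \<Rightarrow> ('xh \<times> 'q \<Rightarrow> 'uh measure) \<Rightarrow> nat \<Rightarrow> 'xh \<Rightarrow> 'q \<Rightarrow> real" where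
  "robust_iter \<epsilon> \<delta> Mh A L \<mu> l \<equiv> (robust_op \<epsilon> \<delta> Mh A L \<mu> ^^ l) (\<lambda>_ _. 0)"

lemma robust_iter_bounds:
  "0 \<le> robust_iter \<epsilon> \<delta> Mh A L \<mu> l xh q" "robust_iter \<epsilon> \<delta> Mh A L \<mu> l xh q \<le> 1"
  by (cases l; simp add: robust_op_eq clamp01_def)+

lemma nn_integral_le_1:
  assumes "prob_space M" "\<And>x. f x \<le> 1"
  shows "(\<integral>\<^sup>+x. f x \<partial>M) \<le> (1 :: ennreal)"
proof -
  have "(\<integral>\<^sup>+x. f x \<partial>M) \<le> (\<integral>\<^sup>+x. 1 \<partial>M)" using assms(2) by (intro nn_integral_mono) simp
  then show ?thesis using prob_space.emeasure_space_1[OF assms(1)] by simp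
qed

lemma robust_iter_incseq:
  assumes \<epsilon>: "0 \<le> \<epsilon>" and P: "\<And>xh q. prob_space (mix Mh xh (\<mu> (xh, q)))"
  shows "incseq (\<lambda>l. robust_iter \<epsilon> \<delta> Mh A L \<mu> l xh q)"
proof (rule incseq_SucI)
  fix l
  show "robust_iter \<epsilon> \<delta> Mh A L \<mu> l xh q \<le> robust_iter \<epsilon> \<delta> Mh A L \<mu> (Suc l) xh q"
  proof (induction l arbitrary: xh q)
    case 0
    then show ?case by (simp add: robust_op_eq clamp01_def)
  next
    case (Suc l)
    let ?I = "\<lambda>l. \<integral>\<^sup>+ xh'. ennreal (robust_integrand \<epsilon> Mh A L (robust_iter \<epsilon> \<delta> Mh A L \<mu> l) q xh')
      \<partial>mix Mh xh (\<mu> (xh, q))"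
    have "?I l \<le> ?I (Suc l)"
      by (intro nn_integral_mono ennreal_leI robust_integrand_mono \<epsilon> Suc.IH)
    \<comment> \<open>\<open>enn2real\<close> sends infinity to 0 and is monotone only below
      it.\<close>
    moreover have "?I (Suc l) \<le> 1"
      by (intro nn_integral_le_1 P ennreal_le_1[THEN iffD2] robust_integrand_le_1 \<epsilon> robust_iter_bounds)
    ultimately have "enn2real (?I l) - \<delta> \<le> enn2real (?I (Suc l)) - \<delta>"
      by (intro diff_right_mono enn2real_mono) (auto simp: less_top[symmetric] top_unique)
    then have "clamp01 (enn2real (?I l) - \<delta>) \<le> clamp01 (enn2real (?I (Suc l)) - \<delta>)"
      by (auto simp: clamp01_def)
    moreover have "robust_iter \<epsilon> \<delta> Mh A L \<mu> (Suc k) xh q = clamp01 (enn2real (?I k) - \<delta>)" for k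
      by (simp add: robust_op_eq)
    ultimately show ?case by (simp only:)
  qed
qed

lemma robust_iter_tendsto_V_inf:
  assumes "0 \<le> \<epsilon>" "\<And>xh q. prob_space (mix Mh xh (\<mu> (xh, q)))"
  shows "(\<lambda>l. robust_iter \<epsilon> \<delta> Mh A L \<mu> l xh q) \<longlonglongrightarrow> V_inf \<epsilon> \<delta> Mh A L \<mu> xh q"
proof -
  obtain a where "(\<lambda>l. robust_iter \<epsilon> \<delta> Mh A L \<mu> l xh q) \<longlonglongrightarrow> a"
    by (rule incseq_convergent[OF robust_iter_incseq[OF assms] allI[OF robust_iter_bounds(2)]])
  then have "convergent (\<lambda>l. robust_iter \<epsilon> \<delta> Mh A L \<mu> l xh q)" by (auto simp: convergent_def)
  then show ?thesis unfolding V_inf_def by (simp add: convergent_LIMSEQ_iff)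
qed

subsection \<open>The lifted strategy\<close>

text \<open>What survives of the interface is \<open>W_snd\<close>, the bare attainability of each
  second marginal; \<open>v\<close> is the measurable choice that takes its place.\<close>

locale lifting =
  fixes Mh :: "('xh::polish_space, 'uh::polish_space, 'y::metric_space) gmdp"
    and M :: "('x::polish_space, 'u::polish_space, 'y) gmdp"
    and A :: "('q::finite, 'ap::finite) dfa"
    and L :: "'y \<Rightarrow> 'ap set"
    and \<epsilon> \<delta> :: real
    and \<mu> :: "'xh \<times> 'q \<Rightarrow> 'uh measure"
    and R :: "('xh \<times> 'x) set"
    and W :: "'uh \<Rightarrow> 'xh \<Rightarrow> 'x \<Rightarrow> ('xh \<times> 'x) measure"
    and v :: "'x \<times> real \<Rightarrow> 'u measure"
  assumes Mh: "gmdp Mh" and M: "gmdp M"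
    and L: "L \<in> borel \<rightarrow>\<^sub>M count_space UNIV"
    and \<epsilon>: "0 \<le> \<epsilon>" and \<delta>: "0 \<le> \<delta>"
    and \<mu>: "markov_policy \<mu>"
    and R: "R \<in> sets borel"
    and W: "(\<lambda>(uh, xh, x). W uh xh x) \<in> borel \<rightarrow>\<^sub>M prob_algebra borel"
    and R_dist: "\<And>xh x. (xh, x) \<in> R \<Longrightarrow> dist (out Mh xh) (out M x) \<le> \<epsilon>"
    and W_fst: "\<And>xh x uh. (xh, x) \<in> R \<Longrightarrow> distr (W uh xh x) borel fst = trans Mh xh uh"
    and W_snd: "\<And>xh x uh. (xh, x) \<in> R \<Longrightarrow>
      \<exists>\<nu>\<in>space (prob_algebra borel). mix M x \<nu> = distr (W uh xh x) borel snd"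
    and W_R: "\<And>xh x uh. (xh, x) \<in> R \<Longrightarrow> 1 - \<delta> \<le> measure (W uh xh x) R"
    and v: "v \<in> univ_measurable borel (prob_algebra borel)"
    and v_mix: "\<And>x \<nu>. \<nu> \<in> space (prob_algebra borel) \<Longrightarrow>
      mix M x (v (x, mcode (mix M x \<nu>))) = mix M x \<nu>"
begin

definition coupling :: "'xh \<Rightarrow> 'x \<Rightarrow> 'q \<Rightarrow> ('xh \<times> 'x) measure" where
  "coupling xh x q = bind (\<mu> (xh, q)) (\<lambda>uh. W uh xh x)"

definition mem :: "'xh \<Rightarrow> 'x \<Rightarrow> 'q \<Rightarrow> real" where
  "mem xh x q = enc (xh, x, real (to_nat_on UNIV q))"

definition mem_xh :: "real \<Rightarrow> 'xh" where
  "mem_xh m = fst (dec m :: 'xh \<times> 'x \<times> real)"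

definition mem_x :: "real \<Rightarrow> 'x" where
  "mem_x m = fst (snd (dec m :: 'xh \<times> 'x \<times> real))"

text \<open>Rounding down makes the automaton component total and measurable on reals that are not
  codes of memories.\<close>

definition mem_q :: "real \<Rightarrow> 'q" where
  "mem_q m = from_nat_into UNIV (nat \<lfloor>snd (snd (dec m :: 'xh \<times> 'x \<times> real))\<rfloor>)"

definition mem_coupling :: "real \<Rightarrow> ('xh \<times> 'x) measure" where
  "mem_coupling m = coupling (mem_xh m) (mem_x m) (mem_q m)"

text \<open>The stored automaton state has already read the label of the stored concrete state,
  hence the \<open>dtau\<close> in \<open>mem0\<close>. This matches \<open>V_inf\<close>, whose
  automaton argument is the state after the initial label.\<close>

definition strat :: "('x, 'u) strategy" where
  "strat = \<lparr>mem0 = mem (init Mh) (init M) (dtau A (dq0 A) (L (out M (init M)))),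
     ctrans = (\<lambda>m x'. distr (disint (mem_coupling m) x') borel
       (\<lambda>xh'. mem xh' x' (dtau A (mem_q m) (L (out M x'))))),
     cout = (\<lambda>m. v (mem_x m, mcode (distr (mem_coupling m) borel snd)))\<rparr>"

lemma mem_proj [simp]: "mem_xh (mem xh x q) = xh" "mem_x (mem xh x q) = x" "mem_q (mem xh x q) = q"
  by (simp_all add: mem_xh_def mem_x_def mem_q_def mem_def countable_finite)

lemma measurable_mem_proj [measurable]:
  "mem_xh \<in> borel_measurable borel" "mem_x \<in> borel_measurable borel"
  "mem_q \<in> borel \<rightarrow>\<^sub>M count_space UNIV"
proof -
  have [measurable]: "(dec :: real \<Rightarrow> 'xh \<times> 'x \<times> real) \<in> borel \<rightarrow>\<^sub>M borel \<Otimes>\<^sub>M (borel \<Otimes>\<^sub>M borel)"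
    by (simp add: borel_prod)
  show "mem_xh \<in> borel_measurable borel" "mem_x \<in> borel_measurable borel"
    unfolding mem_xh_def[abs_def] mem_x_def[abs_def] by measurable
  have "(\<lambda>m. nat \<lfloor>snd (snd (dec m :: 'xh \<times> 'x \<times> real))\<rfloor>) \<in> borel \<rightarrow>\<^sub>M count_space UNIV"
    by measurable
  then show "mem_q \<in> borel \<rightarrow>\<^sub>M count_space UNIV"
    unfolding mem_q_def[abs_def] by (rule measurable_compose) simp
qed

lemma mu_in_prob_algebra: "\<mu> (xh, q) \<in> space (prob_algebra borel)"
  using \<mu> unfolding markov_policy_def by (rule univ_measurable_space) (simp add: space_pair_measure)

lemma measurable_W [measurable]:
  assumes [measurable]: "f \<in> borel_measurable N" "g \<in> borel_measurable N" "h \<in> borel_measurable N"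
  shows "(\<lambda>z. W (f z) (g z) (h z)) \<in> N \<rightarrow>\<^sub>M prob_algebra borel"
proof -
  have "(\<lambda>z. (f z, g z, h z)) \<in> N \<rightarrow>\<^sub>M borel \<Otimes>\<^sub>M (borel \<Otimes>\<^sub>M borel)" by measurable
  then have "(\<lambda>z. (f z, g z, h z)) \<in> N \<rightarrow>\<^sub>M borel" by (simp add: borel_prod)
  from measurable_compose[OF this W] show ?thesis by simp
qed

lemma W_in_prob_algebra: "W uh xh x \<in> space (prob_algebra borel)"
  using measurable_space[OF W, of "(uh, xh, x)"] by simp

lemma coupling_in_prob_algebra: "coupling xh x q \<in> space (prob_algebra borel)"
  unfolding coupling_def by (rule bind_in_prob_algebra[OF mu_in_prob_algebra]) simp

lemma mem_coupling_univ: "mem_coupling \<in> univ_measurable borel (prob_algebra borel)"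
proof -
  have "(\<lambda>m. (mem_xh m, mem_q m)) \<in> borel \<rightarrow>\<^sub>M borel \<Otimes>\<^sub>M count_space UNIV" by measurable
  then have "(\<lambda>m. \<mu> (mem_xh m, mem_q m)) \<in> univ_measurable borel (prob_algebra borel)"
    using \<mu> unfolding markov_policy_def
    by (rule univ_measurable_compose[OF measurable_imp_univ_measurable])
  then have 1: "(\<lambda>m. (\<mu> (mem_xh m, mem_q m), m)) \<in> univ_measurable borel (prob_algebra borel \<Otimes>\<^sub>M borel)"
    by (rule univ_measurable_Pair) (rule measurable_imp_univ_measurable, simp)
  have 2: "(\<lambda>z. bind (fst z) (\<lambda>uh. W uh (mem_xh (snd z)) (mem_x (snd z))))
      \<in> prob_algebra borel \<Otimes>\<^sub>M borel \<rightarrow>\<^sub>M prob_algebra borel"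
    by (rule measurable_bind_prob_space2[where N = borel]) measurable
  show ?thesis
    using univ_measurable_compose_measurable[OF 1 2] by (simp add: mem_coupling_def[abs_def] coupling_def)
qed

lemma snd_distr_measurable:
  "(\<lambda>w :: ('xh \<times> 'x) measure. distr w borel snd) \<in> prob_algebra borel \<rightarrow>\<^sub>M prob_algebra borel"
  by (rule measurable_distr_prob_space) (simp flip: borel_prod)

lemma cout_univ: "cout strat \<in> univ_measurable borel (prob_algebra borel)"
proof -
  have "(\<lambda>m. mcode (distr (mem_coupling m) borel snd)) \<in> univ_measurable borel borel"
    by (rule univ_measurable_compose_measurable[OF mem_coupling_univ
          measurable_compose[OF snd_distr_measurable measurable_mcode]])
  moreover have "mem_x \<in> univ_measurable borel borel"
    by (rule measurable_imp_univ_measurable) simp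
  ultimately have "(\<lambda>m. (mem_x m, mcode (distr (mem_coupling m) borel snd))) \<in> univ_measurable borel borel"
    unfolding borel_prod[symmetric] by (rule univ_measurable_Pair[rotated])
  from univ_measurable_compose[OF this v] show ?thesis by (simp add: strat_def)
qed

lemma measurable_label: "(\<lambda>x. L (out M x)) \<in> borel \<rightarrow>\<^sub>M count_space UNIV"
  using M L unfolding gmdp_def by (auto intro: measurable_compose)

lemma measurable_mem:
  assumes [measurable]: "f \<in> borel_measurable N" "g \<in> borel_measurable N" "h \<in> N \<rightarrow>\<^sub>M count_space UNIV"
  shows "(\<lambda>z. mem (f z) (g z) (h z)) \<in> borel_measurable N"
proof -
  have [measurable]: "(\<lambda>z. real (to_nat_on UNIV (h z))) \<in> borel_measurable N"
    by (rule measurable_compose[OF assms(3)]) simp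
  have "(\<lambda>z. (f z, g z, real (to_nat_on UNIV (h z)))) \<in> N \<rightarrow>\<^sub>M borel \<Otimes>\<^sub>M (borel \<Otimes>\<^sub>M borel)" by measurable
  then have "(\<lambda>z. (f z, g z, real (to_nat_on UNIV (h z)))) \<in> N \<rightarrow>\<^sub>M borel" by (simp add: borel_prod)
  from measurable_compose[OF this measurable_enc] show ?thesis by (simp add: mem_def)
qed

lemma measurable_next_q:
  assumes "f \<in> N \<rightarrow>\<^sub>M count_space UNIV" "g \<in> borel_measurable N"
  shows "(\<lambda>z. dtau A (f z) (L (out M (g z)))) \<in> N \<rightarrow>\<^sub>M count_space UNIV"
proof (rule measurable_compose_countable'[OF _ assms(1)])
  show "(\<lambda>z. dtau A q (L (out M (g z)))) \<in> N \<rightarrow>\<^sub>M count_space UNIV" for q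
    by (rule measurable_compose[OF measurable_compose[OF assms(2) measurable_label]]) simp
qed (simp add: countable_finite)

text \<open>The memory enters universally measurably through the joint law; everything applied
  afterwards is Borel, thanks to the joint measurability of \<open>disint\<close>.\<close>

lemma ctrans_univ: "(\<lambda>(m, x). ctrans strat m x) \<in> univ_measurable borel (prob_algebra borel)"
proof -
  have f: "fst \<in> univ_measurable (borel :: (real \<times> 'x) measure) borel"
    by (rule measurable_imp_univ_measurable) (simp flip: borel_prod)
  have "(\<lambda>p :: real \<times> 'x. (mem_coupling (fst p), p)) \<in> univ_measurable borel (prob_algebra borel \<Otimes>\<^sub>M borel)"
    by (rule univ_measurable_Pair[OF univ_measurable_compose[OF f mem_coupling_univ]
          measurable_imp_univ_measurable]) simp
  then have 1: "(\<lambda>p :: real \<times> 'x. (mem_coupling (fst p), p)) \<in>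
      univ_measurable borel (prob_algebra borel \<Otimes>\<^sub>M (borel \<Otimes>\<^sub>M borel))" by (simp add: borel_prod)
  have 2: "(\<lambda>z. distr (disint (fst z) (snd (snd z))) borel
        (\<lambda>xh'. mem xh' (snd (snd z)) (dtau A (mem_q (fst (snd z))) (L (out M (snd (snd z)))))))
      \<in> prob_algebra borel \<Otimes>\<^sub>M (borel \<Otimes>\<^sub>M borel) \<rightarrow>\<^sub>M prob_algebra borel"
  proof (rule measurable_distr_prob_space2[where M = borel])
    have "(\<lambda>z. (fst z, snd (snd z))) \<in> prob_algebra (borel :: ('xh \<times> 'x) measure) \<Otimes>\<^sub>M
        ((borel :: real measure) \<Otimes>\<^sub>M borel) \<rightarrow>\<^sub>M prob_algebra borel \<Otimes>\<^sub>M borel" by measurable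
    from measurable_compose[OF this measurable_disint]
    show "(\<lambda>z. disint (fst z) (snd (snd z))) \<in> prob_algebra (borel :: ('xh \<times> 'x) measure) \<Otimes>\<^sub>M
        ((borel :: real measure) \<Otimes>\<^sub>M borel) \<rightarrow>\<^sub>M prob_algebra borel" by simp
    show "(\<lambda>(z, xh'). mem xh' (snd (snd z)) (dtau A (mem_q (fst (snd z))) (L (out M (snd (snd z))))))
      \<in> borel_measurable ((prob_algebra (borel :: ('xh \<times> 'x) measure) \<Otimes>\<^sub>M (borel \<Otimes>\<^sub>M borel)) \<Otimes>\<^sub>M borel)"
      unfolding split_beta' by (intro measurable_mem measurable_next_q) measurable
  qed
  show ?thesis
    using univ_measurable_compose_measurable[OF 1 2] by (simp add: strat_def split_beta')
qed

lemma strategy_strat: "strategy strat"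
  using cout_univ ctrans_univ by (simp add: strategy_def)

lemma prob_space_mix: "prob_space (mix M x (cout strat m))"
proof -
  have "cout strat m \<in> space (prob_algebra borel)" by (rule univ_measurable_space[OF cout_univ]) simp
  from mix_in_prob_algebra[OF M this] show ?thesis by (simp add: space_prob_algebra)
qed

lemma prob_space_ctrans: "prob_space (ctrans strat m x)"
  using univ_measurable_space[OF ctrans_univ, of "(m, x)"] by (simp add: space_prob_algebra)

lemma prob_space_mix_abs: "prob_space (mix Mh xh (\<mu> (xh, q)))"
  using mix_in_prob_algebra[OF Mh mu_in_prob_algebra] by (simp add: space_prob_algebra)

section \<open>One step of the closed loop from a related pair\<close>

context
  fixes xh :: 'xh and x :: 'x and q :: 'q
  assumes in_R: "(xh, x) \<in> R"
begin

lemma W_section: "(\<lambda>uh. W uh xh x) \<in> borel \<rightarrow>\<^sub>M prob_algebra borel"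
  by measurable

lemma distr_coupling:
  assumes "f \<in> borel_measurable borel"
  shows "distr (coupling xh x q) borel f = bind (\<mu> (xh, q)) (\<lambda>uh. distr (W uh xh x) borel f)"
proof -
  have mu: "sets (\<mu> (xh, q)) = sets borel" "prob_space (\<mu> (xh, q))"
    using mu_in_prob_algebra by (auto simp: space_prob_algebra)
  have "(\<lambda>uh. W uh xh x) \<in> \<mu> (xh, q) \<rightarrow>\<^sub>M subprob_algebra borel"
    using measurable_prob_algebraD[OF W_section] measurable_cong_sets[OF mu(1) refl] by blast
  then show ?thesis
    unfolding coupling_def using mu(2) assms by (intro distr_bind) (auto dest: prob_space.not_empty)
qed

lemma fst_coupling: "distr (coupling xh x q) borel fst = mix Mh xh (\<mu> (xh, q))"
  unfolding mix_def by (subst distr_coupling) (simp_all add: W_fst[OF in_R] flip: borel_prod)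

text \<open>The averaged second marginal is attainable by \<open>mix_bind\<close>, so the law
  selected by \<open>v\<close> attains it. Thus the real closed loop moves exactly as the coupling
  prescribes.\<close>

lemma snd_coupling: "distr (coupling xh x q) borel snd = mix M x (cout strat (mem xh x q))"
proof -
  have snd: "snd \<in> borel_measurable (borel :: ('xh \<times> 'x) measure)" by (simp flip: borel_prod)
  have "\<exists>\<nu>\<in>space (prob_algebra borel). mix M x \<nu> = bind (\<mu> (xh, q)) (\<lambda>uh. distr (W uh xh x) borel snd)"
    by (intro mix_bind[OF M mu_in_prob_algebra] W_snd[OF in_R]
        measurable_compose[OF W_section snd_distr_measurable])
  then obtain \<nu> where "\<nu> \<in> space (prob_algebra borel)" "mix M x \<nu> = distr (coupling xh x q) borel snd"
    unfolding distr_coupling[OF snd] by blast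
  then show ?thesis using v_mix[of \<nu> x] by (simp add: strat_def mem_coupling_def)
qed

lemma coupling_not_R: "emeasure (coupling xh x q) (- R) \<le> ennreal \<delta>"
proof -
  interpret \<mu>: prob_space "\<mu> (xh, q)" using mu_in_prob_algebra by (simp add: space_prob_algebra)
  have nR: "- R \<in> sets borel" using R by (rule borel_comp)
  have "emeasure (coupling xh x q) (- R) = (\<integral>\<^sup>+uh. emeasure (W uh xh x) (- R) \<partial>\<mu> (xh, q))"
    unfolding coupling_def by (rule emeasure_bind_prob_algebra[OF mu_in_prob_algebra W_section nR])
  also have "\<dots> \<le> (\<integral>\<^sup>+uh. ennreal \<delta> \<partial>\<mu> (xh, q))"
  proof (rule nn_integral_mono)
    fix uh
    interpret W: prob_space "W uh xh x" using W_in_prob_algebra by (simp add: space_prob_algebra)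
    have "R \<in> sets (W uh xh x)" "space (W uh xh x) = UNIV"
      using R W_in_prob_algebra[of uh xh x] sets_eq_imp_space_eq[of "W uh xh x" borel]
      by (auto simp: space_prob_algebra)
    then have "measure (W uh xh x) (- R) = 1 - measure (W uh xh x) R"
      using W.prob_compl[of R] by (simp add: Compl_eq_Diff_UNIV)
    then show "emeasure (W uh xh x) (- R) \<le> ennreal \<delta>"
      using W_R[OF in_R, of uh] by (auto simp: W.emeasure_eq_measure intro!: ennreal_leI)
  qed
  also have "\<dots> = ennreal \<delta>" by (simp add: \<mu>.emeasure_space_1)
  finally show ?thesis .
qed

text \<open>Neither \<open>H\<close> nor \<open>F\<close> need be measurable: \<open>nn_integral\<close> is a lower integral, and
  measurable minorants of \<open>H\<close> are transported to minorants of \<open>F\<close>.\<close>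

lemma robust_step:
  fixes H :: "'xh \<Rightarrow> ennreal" and F :: "'x \<Rightarrow> real \<Rightarrow> ennreal"
  assumes H: "\<And>xh'. H xh' \<le> 1"
    and HF: "\<And>xh' x'. (xh', x') \<in> R \<Longrightarrow> H xh' \<le> F x' (mem xh' x' (dtau A q (L (out M x'))))"
  shows "(\<integral>\<^sup>+xh'. H xh' \<partial>mix Mh xh (\<mu> (xh, q))) \<le> ennreal \<delta> +
    (\<integral>\<^sup>+x'. (\<integral>\<^sup>+m'. F x' m' \<partial>ctrans strat (mem xh x q) x') \<partial>mix M x (cout strat (mem xh x q)))"
    (is "_ \<le> _ + ?rhs")
  unfolding nn_integral_def[of _ H]
proof (rule SUP_least, elim CollectE conjE)
  let ?w = "coupling xh x q"
  note w = coupling_in_prob_algebra[of xh x q]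
  interpret w: prob_space ?w using w by (simp add: space_prob_algebra)
  note [measurable_cong] = sets_joint[OF w]
  have Rw: "R \<in> sets ?w" "- R \<in> sets ?w"
    using R borel_comp[OF R] by (simp_all add: sets_joint[OF w])
  have mix_sets: "sets (mix Mh xh (\<mu> (xh, q))) = sets borel"
    using mix_in_prob_algebra[OF Mh mu_in_prob_algebra] by (simp add: space_prob_algebra)
  fix g assume g: "simple_function (mix Mh xh (\<mu> (xh, q))) g" "g \<le> H"
  have gb: "g \<in> borel_measurable borel"
    using borel_measurable_simple_function[OF g(1)] measurable_cong_sets[OF mix_sets refl] by blast
  have fst: "fst \<in> borel_measurable (borel :: ('xh \<times> 'x) measure)" by (simp flip: borel_prod)
  have fstw: "fst \<in> borel_measurable ?w" using fst measurable_cong_sets[OF sets_joint[OF w] refl] by blast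
  \<comment> \<open>Cutting off outside \<open>R\<close> costs at most the mass of the complement
    because \<open>g\<close> is at most 1; that mass is the \<open>\<delta>\<close> of the
    estimate.\<close>
  define G where "G p = g (fst p) * indicator R p" for p
  have Gb: "G \<in> borel_measurable borel"
    unfolding G_def[abs_def]
    by (intro borel_measurable_times_ennreal measurable_compose[OF fst gb] borel_measurable_indicator R)
  have Gw: "G \<in> borel_measurable ?w" using Gb measurable_cong_sets[OF sets_joint[OF w] refl] by blast
  have "integral\<^sup>S (mix Mh xh (\<mu> (xh, q))) g = (\<integral>\<^sup>+xh'. g xh' \<partial>distr ?w borel fst)"
    using nn_integral_eq_simple_integral[OF g(1)] by (simp add: fst_coupling)
  also have "\<dots> = (\<integral>\<^sup>+p. g (fst p) \<partial>?w)"
    by (rule nn_integral_distr[OF fstw]) (use gb in simp)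
  also have "\<dots> \<le> (\<integral>\<^sup>+p. indicator (- R) p + G p \<partial>?w)"
  proof (rule nn_integral_mono)
    fix p :: "'xh \<times> 'x"
    have "g (fst p) \<le> 1" using g(2) H by (auto simp: le_fun_def intro: order_trans)
    then show "g (fst p) \<le> indicator (- R) p + G p"
      by (auto simp: G_def split: split_indicator)
  qed
  also have "\<dots> = emeasure ?w (- R) + (\<integral>\<^sup>+p. G p \<partial>?w)"
    using Rw Gw by (subst nn_integral_add) auto
  also have "\<dots> \<le> ennreal \<delta> + (\<integral>\<^sup>+p. G p \<partial>?w)" by (intro add_right_mono coupling_not_R)
  also have "(\<integral>\<^sup>+p. G p \<partial>?w) = (\<integral>\<^sup>+x'. (\<integral>\<^sup>+xh'. G (xh', x') \<partial>disint ?w x') \<partial>mix M x (cout strat (mem xh x q)))"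
    unfolding snd_coupling[symmetric] by (rule nn_integral_disint[OF w Gb])
  also have "\<dots> \<le> ?rhs"
  proof (rule nn_integral_mono)
    fix x'
    let ?q = "dtau A q (L (out M x'))"
    define e where "e xh' = mem xh' x' ?q" for xh'
    have e_meas: "e \<in> borel_measurable borel"
      unfolding e_def[abs_def] by (intro measurable_mem) auto
    \<comment> \<open>Carries \<open>G\<close> from abstract states to memories: a memory of the
      form \<open>e xh'\<close> receives the value at \<open>xh'\<close>, all others receive 0. This
      is a Borel minorant of \<open>F x'\<close>.\<close>
    define G' where "G' m' = (if e (mem_xh m') = m' then G (mem_xh m', x') else 0)" for m'
    have G1: "(\<lambda>xh'. G (xh', x')) \<in> borel_measurable borel"
      by (rule measurable_compose[OF _ Gb]) (subst borel_prod[symmetric], measurable)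
    have [measurable]: "(\<lambda>m'. G (mem_xh m', x')) \<in> borel_measurable borel"
      "(\<lambda>m'. e (mem_xh m')) \<in> borel_measurable borel"
      by (rule measurable_compose[OF _ G1] measurable_compose[OF _ e_meas], measurable)+
    have G'b: "G' \<in> borel_measurable borel" unfolding G'_def[abs_def] by measurable
    have ds: "sets (disint ?w x') = sets borel"
      using measurable_space[OF measurable_disint, of "(?w, x')"] w
      by (simp add: space_pair_measure space_prob_algebra)
    have G'F: "G' m' \<le> F x' m'" for m'
    proof (cases "e (mem_xh m') = m' \<and> (mem_xh m', x') \<in> R")
      case True
      then have "G' m' \<le> H (mem_xh m')" using g(2) by (simp add: G'_def G_def le_fun_def)
      also have "\<dots> \<le> F x' (e (mem_xh m'))" unfolding e_def using True by (intro HF) simp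
      finally show ?thesis using True by simp
    qed (auto simp: G'_def G_def)
    have "(\<integral>\<^sup>+xh'. G (xh', x') \<partial>disint ?w x') = (\<integral>\<^sup>+xh'. G' (e xh') \<partial>disint ?w x')"
      by (intro nn_integral_cong) (simp add: G'_def e_def)
    also have "\<dots> = (\<integral>\<^sup>+m'. G' m' \<partial>distr (disint ?w x') borel e)"
      by (rule nn_integral_distr[symmetric])
         (use e_meas G'b in \<open>auto simp: measurable_cong_sets[OF ds refl]\<close>)
    also have "distr (disint ?w x') borel e = ctrans strat (mem xh x q) x'"
      by (simp add: strat_def mem_coupling_def e_def[abs_def])
    also have "(\<integral>\<^sup>+m'. G' m' \<partial>ctrans strat (mem xh x q) x') \<le> (\<integral>\<^sup>+m'. F x' m' \<partial>ctrans strat (mem xh x q) x')"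
      by (intro nn_integral_mono G'F)
    finally show "(\<integral>\<^sup>+xh'. G (xh', x') \<partial>disint ?w x') \<le> (\<integral>\<^sup>+m'. F x' m' \<partial>ctrans strat (mem xh x q) x')" .
  qed
  finally show "integral\<^sup>S (mix Mh xh (\<mu> (xh, q))) g \<le> ennreal \<delta> + ?rhs" by (simp add: add_left_mono)
qed

end

text \<open>Induction on the horizon for all related pairs and all histories at once,
  \<open>q\<close> being the automaton state after the history and the current output.\<close>

lemma cyl_prob_ge_robust_iter:
  assumes acc: "\<forall>w. accepts A w \<longleftrightarrow> sat w \<psi>" and "(xh, x) \<in> R"
    and "q = foldl (dtau A) (dq0 A) (map L (ys @ [out M x]))"
  shows "ennreal (max (indF A q) (robust_iter \<epsilon> \<delta> Mh A L \<mu> n xh q))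
    \<le> cyl_prob strat M (\<lambda>ys. good_prefix \<psi> (map L ys)) n x (mem xh x q) ys"
  using assms(2,3)
proof (induction n arbitrary: xh x q ys)
  case (0 xh x q ys)
  then have "q \<in> dF A \<Longrightarrow> good_prefix \<psi> (map L (ys @ [out M x]))"
    using good_prefix_accepting[OF acc] by blast
  then show ?case by (simp add: indF_def)
next
  case (Suc n xh x q ys)
  let ?E = "\<lambda>ys. good_prefix \<psi> (map L ys)" and ?V = "robust_iter \<epsilon> \<delta> Mh A L \<mu>"
  show ?case
  proof (cases "q \<in> dF A")
    case True
    then have "?E (ys @ [out M x])" using Suc.prems good_prefix_accepting[OF acc] by blast
    then have "cyl_prob strat M ?E (Suc n) x (mem xh x q) ys = 1"
      by (intro cyl_prob_eq_1 prob_space_mix prob_space_ctrans) (simp_all add: good_prefix_append)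
    moreover have "max (indF A q) (?V (Suc n) xh q) \<le> 1"
      using robust_iter_bounds(2)[where l = "Suc n"] by (auto simp: indF_def simp del: funpow.simps)
    ultimately show ?thesis by (simp only: ennreal_le_1)
  next
    case False
    define H where "H xh' = ennreal (robust_integrand \<epsilon> Mh A L (?V n) q xh')" for xh'
    define F where "F x' m' = cyl_prob strat M ?E n x' m' (ys @ [out M x])" for x' m'
    have H1: "H xh' \<le> 1" for xh'
      unfolding H_def by (intro ennreal_le_1[THEN iffD2] robust_integrand_le_1 \<epsilon> robust_iter_bounds)
    have HF: "H xh' \<le> F x' (mem xh' x' (dtau A q (L (out M x'))))" if "(xh', x') \<in> R" for xh' x'
    proof -
      let ?q = "dtau A q (L (out M x'))"
      have "H xh' \<le> ennreal (max (indF A ?q) (?V n xh' ?q))"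
        unfolding H_def using R_dist[OF that]
        by (intro ennreal_leI robust_integrand_le) (simp add: dist_commute)
      also have "\<dots> \<le> F x' (mem xh' x' ?q)"
        unfolding F_def by (rule Suc.IH[OF that]) (simp add: Suc.prems(2))
      finally show ?thesis .
    qed
    let ?I = "\<integral>\<^sup>+xh'. H xh' \<partial>mix Mh xh (\<mu> (xh, q))"
    let ?c = "cyl_prob strat M ?E (Suc n) x (mem xh x q) ys"
    have I: "?I \<le> ennreal \<delta> + ?c"
      using robust_step[OF Suc.prems(1), of H F q, OF H1 HF] by (simp add: F_def nn_integral_completion)
    have "?I \<le> 1" by (intro nn_integral_le_1 prob_space_mix_abs H1)
    then have fin: "?I < \<top>" by (auto simp: less_top[symmetric] top_unique)
    have "?V (Suc n) xh q = clamp01 (enn2real ?I - \<delta>)" by (simp add: robust_op_eq H_def)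
    \<comment> \<open>The upper clamp only lowers the value, and the indicator vanishes in this
      case.\<close>
    then have "max (indF A q) (?V (Suc n) xh q) \<le> max 0 (enn2real ?I - \<delta>)"
      using False by (simp add: clamp01_def indF_def del: funpow.simps)
    then have "ennreal (max (indF A q) (?V (Suc n) xh q)) \<le> ennreal (max 0 (enn2real ?I - \<delta>))"
      by (rule ennreal_leI)
    \<comment> \<open>The lower clamp is absorbed because \<open>ennreal\<close> sends negative
      reals to 0.\<close>
    also have "\<dots> = ennreal (enn2real ?I - \<delta>)" by (simp add: max_def ennreal_neg)
    also have "\<dots> = ?I - ennreal \<delta>"
      using \<delta> fin by (simp add: ennreal_minus[symmetric])
    also have "\<dots> \<le> ?c" using I fin by (simp add: ennreal_minus_le_iff less_top del: cyl_prob.simps)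
    finally show ?thesis .
  qed
qed

text \<open>The initial concrete label is among those minimised over, so \<open>S_value\<close> is
  bounded by the value at the true automaton state. Each iterate there is below the satisfaction
  probability, and so is the limit.\<close>

lemma S_value_le_sat_prob:
  assumes acc: "\<forall>w. accepts A w \<longleftrightarrow> sat w \<psi>" and init: "(init Mh, init M) \<in> R"
  shows "ennreal (S_value \<epsilon> \<delta> Mh A L \<mu>) \<le> sat_prob strat M L \<psi>"
proof -
  define q where "q = dtau A (dq0 A) (L (out M (init M)))"
  let ?V = "\<lambda>n. robust_iter \<epsilon> \<delta> Mh A L \<mu> n (init Mh) q"
  have "S_value \<epsilon> \<delta> Mh A L \<mu> = robust_integrand \<epsilon> Mh A L (V_inf \<epsilon> \<delta> Mh A L \<mu>) (dq0 A) (init Mh)"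
    by (simp add: S_value_def robust_integrand_def)
  also have "\<dots> \<le> max (indF A q) (V_inf \<epsilon> \<delta> Mh A L \<mu> (init Mh) q)"
    unfolding q_def using R_dist[OF init] by (intro robust_integrand_le) (simp add: dist_commute)
  finally have "ennreal (S_value \<epsilon> \<delta> Mh A L \<mu>) \<le> ennreal (max (indF A q) (V_inf \<epsilon> \<delta> Mh A L \<mu> (init Mh) q))"
    by (rule ennreal_leI)
  also have "\<dots> \<le> sat_prob strat M L \<psi>"
  proof (rule LIMSEQ_le_const2)
    show "(\<lambda>n. ennreal (max (indF A q) (?V n))) \<longlonglongrightarrow> ennreal (max (indF A q) (V_inf \<epsilon> \<delta> Mh A L \<mu> (init Mh) q))"
      by (intro tendsto_ennrealI tendsto_max tendsto_const robust_iter_tendsto_V_inf \<epsilon> prob_space_mix_abs)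
    have "ennreal (max (indF A q) (?V n)) \<le> sat_prob strat M L \<psi>" for n
    proof -
      have "ennreal (max (indF A q) (?V n))
          \<le> cyl_prob strat M (\<lambda>ys. good_prefix \<psi> (map L ys)) n (init M) (mem (init Mh) (init M) q) []"
        by (rule cyl_prob_ge_robust_iter[OF acc init]) (simp add: q_def)
      also have "\<dots> \<le> sat_prob strat M L \<psi>"
        unfolding sat_prob_def by (rule SUP_upper2[of n]) (simp_all add: strat_def q_def)
      finally show ?thesis .
    qed
    then show "\<exists>N. \<forall>n\<ge>N. ennreal (max (indF A q) (?V n)) \<le> sat_prob strat M L \<psi>" by blast
  qed
  finally show ?thesis .
qed

end

theorem theorem4:
  fixes Mh :: "('xh::polish_space, 'uh::polish_space, 'y::metric_space) gmdp"
    and A :: "('q::finite, 'ap::finite) dfa"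
    and \<psi> :: "'ap scltl"
    and L :: "'y \<Rightarrow> 'ap set"
    and \<epsilon> \<delta> :: real
    and \<mu> :: "'xh \<times> 'q \<Rightarrow> 'uh measure"
  assumes "gmdp Mh"
    and "L \<in> borel \<rightarrow>\<^sub>M count_space UNIV"
    and "\<forall>w. accepts A w \<longleftrightarrow> sat w \<psi>"
    and "0 \<le> \<epsilon>" and "0 \<le> \<delta>"
    and "markov_policy \<mu>"
  shows "\<forall>M :: ('x::polish_space, 'u::polish_space, 'y) gmdp.
           gmdp M \<and> sim_rel \<epsilon> \<delta> Mh M \<longrightarrow>
           (\<exists>C :: ('x, 'u) strategy. strategy C \<and>
              ennreal (S_value \<epsilon> \<delta> Mh A L \<mu>) \<le> sat_prob C M L \<psi>)"
proof (intro allI impI, elim conjE)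
  fix M :: "('x, 'u, 'y) gmdp"
  assume M: "gmdp M" and sim: "sim_rel \<epsilon> \<delta> Mh M"
  obtain Uv :: "'uh \<Rightarrow> 'xh \<Rightarrow> 'x \<Rightarrow> 'u measure" and R :: "('xh \<times> 'x) set"
    and W :: "'uh \<Rightarrow> 'xh \<Rightarrow> 'x \<Rightarrow> ('xh \<times> 'x) measure" where
    Uv: "\<And>uh xh x. Uv uh xh x \<in> space (prob_algebra borel)"
    and R: "R \<in> sets borel" and W: "(\<lambda>(uh, xh, x). W uh xh x) \<in> borel \<rightarrow>\<^sub>M prob_algebra borel"
    and init: "(init Mh, init M) \<in> R"
    and sim': "\<forall>(xh, x)\<in>R. dist (out Mh xh) (out M x) \<le> \<epsilon> \<and>
       (\<forall>uh. distr (W uh xh x) borel fst = trans Mh xh uh \<and>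
             distr (W uh xh x) borel snd = mix M x (Uv uh xh x) \<and>
             measure (W uh xh x) R \<ge> 1 - \<delta>)"
    using sim unfolding sim_rel_def by blast
  obtain v :: "'x \<times> real \<Rightarrow> 'u measure" where
    v: "v \<in> univ_measurable borel (prob_algebra borel)"
      "\<And>x \<nu>. \<nu> \<in> space (prob_algebra borel) \<Longrightarrow> mix M x (v (x, mcode (mix M x \<nu>))) = mix M x \<nu>"
    using input_selection[OF M] by blast
  interpret lifting Mh M A L \<epsilon> \<delta> \<mu> R W v
  proof
    show "\<exists>\<nu>\<in>space (prob_algebra borel). mix M x \<nu> = distr (W uh xh x) borel snd"
      if "(xh, x) \<in> R" for xh x uh
      \<comment> \<open>The given interface enters here, as a pointwise witness of
        attainability.\<close>
      using sim' that Uv[of uh xh x] by (intro bexI[of _ "Uv uh xh x"]) auto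
  qed (use assms M R W v sim' in auto)
  show "\<exists>C :: ('x, 'u) strategy. strategy C \<and> ennreal (S_value \<epsilon> \<delta> Mh A L \<mu>) \<le> sat_prob C M L \<psi>"
    using strategy_strat S_value_le_sat_prob[OF assms(3) init] by blast
qed

end
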